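(* Let $\{a^{(n)}(k)\}$, $\{b^{(n)}(k)\}$, $\{c_\pm^{(n)}(k)\}$ be coefficient sequences satisfying the standing coefficient conditions listed in the context, and let $D(f,g)=(\delta f,\delta g)$ be the associated Dirac type operator on the mirror quantum sphere, acting in $\mathcal{H}=\mathcal{H}_1\oplus\mathcal{H}_1$ with domain $$\mathrm{dom}(D)=\{(f,g)\in\mathcal{H}:\ \|\delta f\|<\infty,\ \|\delta g\|<\infty,\ f_0^+(\infty)=g_0^+(\infty),\ f_n^+(\infty)=g_n^-(\infty)\text{ and } f_n^-(\infty)=g_n^+(\infty)\text{ for all } n\ge 1\}.$$ Then $D$ is right invertible and is left invertible modulo compact operators. Moreover $D$ has a compact parametrix.
   Context: Coefficient conditions (indices $n,k\in\{0,1,2,\dots\}$). (i) $a^{(n)}(k)>0$, the sum $s(n):=\sum_{k=0}^\infty \frac{1}{a^{(n)}(k)}$ is finite for every $n$, and $s(n)\to 0$ as $n\to\infty$. (ii) $b^{(n)}(k)>0$, the sum $t(n):=\sum_{k=0}^\infty \frac{a^{(n)}(k)}{b^{(n)}(k)^2}$ is finite for every $n$, and $t(n)$ is bounded in $n$. (iii) $c_+^{(n)}(k)$, $c_-^{(n)}(k)$ are real numbers for which there is $\kappa>0$, independent of $M,N,n$, with $\kappa\le\prod_{k=M}^N c_\pm^{(n)}(k)\le\frac1\kappa$ for all $M\le N$ and all $n$; moreover the infinite products $\prod_{k=0}^\infty\frac{1}{c_\pm^{(n)}(k)}$ exist for each $n$. Sequence spaces. $\ell^2_{a^{(n)}}(\mathbb{N})$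 is the space of complex sequences $\{f(k)\}_{k\ge 0}$ with $\|f\|^2_{a^{(n)}}=\sum_{k\ge0}\frac{1}{a^{(n)}(k)}|f(k)|^2<\infty$. Jacobi type operators (with the convention $f(-1)=0$): $\overline{A}^{(n)}f(k)=b^{(n+1)}(k)\big(f(k)-c_+^{(n)}(k)f(k+1)\big)$, from $\ell^2_{a^{(n)}}(\mathbb{N})$ to $\ell^2_{a^{(n+1)}}(\mathbb{N})$, with domain $\{f\in\ell^2_{a^{(n)}}(\mathbb{N}):\|\overline{A}^{(n)}f\|_{a^{(n+1)}}<\infty\}$; $A^{(n)}f(k)=b^{(n)}(k)\big(f(k)-c_-^{(n)}(k-1)f(k-1)\big)$, from $\ell^2_{a^{(n+1)}}(\mathbb{N})$ to $\ell^2_{a^{(n)}}(\mathbb{N})$, with domain $\{f\in\ell^2_{a^{(n+1)}}(\mathbb{N}):\|A^{(n)}f\|_{a^{(n)}}<\infty\}$. Hilbert space. Let $U$ be the unilateral shift on $\ell^2(\mathbb{N})$, $Ue_k=e_{k+1}$, and $Ke_k=ke_k$. $\mathcal{H}_1$ is the Hilbert space of formal series $f=\sum_{n\ge0}U^nf_n^+(K)+\sum_{n\ge1}f_n^-(K)(U^* )^n$ (i.e. of families of complex sequences $f_n^+$, $n\ge0$, and $f_n^-$, $n\ge1$) with finite norm $\|f\|^2=\sum_{n\ge0}\sum_{k\ge0}\frac{1}{a^{(n)}(k)}|f_n^+(k)|^2+\sum_{n\ge1}\sum_{k\ge0}\frac{1}{a^{(n)}(k)}|f_n^-(k)|^2$.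 Operator $\delta$. For such a formal series, $\delta f=-\sum_{n\ge0}U^{n+1}(\overline{A}^{(n)}f_n^+)(K)+\sum_{n\ge1}(A^{(n-1)}f_n^-)(K)(U^* )^{n-1}$. For a sequence $h$, $h(\infty):=\lim_{k\to\infty}h(k)$ (these limits exist for the coefficients of $f$ whenever $f\in\mathcal{H}_1$ and $\|\delta f\|<\infty$). Terminology. $D$ is right invertible if there is a bounded operator $Q$ on $\mathcal{H}$ with range in $\mathrm{dom}(D)$ and $DQ=I$; $D$ is left invertible modulo compact operators if there is a bounded operator $Q$ on $\mathcal{H}$ and a compact operator $C$ with $QD=I-C$ on $\mathrm{dom}(D)$; a parametrix of $D$ is a bounded operator $Q$ that inverts $D$ from both sides modulo compact operators, with range in $\mathrm{dom}(D)$. *)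

theory Defs
  imports "HOL-Analysis.Analysis" "HOL-Library.Function_Algebras"
begin

text \<open>
  Coefficients are written \<open>a n k\<close> for $a^{(n)}(k)$, and likewise for \<open>b\<close>, \<open>cp\<close> ($c_+$)
  and \<open>cm\<close> ($c_-$).
\<close>

definition coeff_cond_a :: "(nat \<Rightarrow> nat \<Rightarrow> real) \<Rightarrow> bool" where
  "coeff_cond_a a \<longleftrightarrow>
     (\<forall>n k. a n k > 0) \<and>
     (\<forall>n. summable (\<lambda>k. 1 / a n k)) \<and>
     (\<lambda>n. \<Sum>k. 1 / a n k) \<longlonglongrightarrow> 0"

definition coeff_cond_b :: "(nat \<Rightarrow> nat \<Rightarrow> real) \<Rightarrow> (nat \<Rightarrow> nat \<Rightarrow> real) \<Rightarrow> bool" where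
  "coeff_cond_b a b \<longleftrightarrow>
     (\<forall>n k. b n k > 0) \<and>
     (\<forall>n. summable (\<lambda>k. a n k / (b n k)\<^sup>2)) \<and>
     bounded (range (\<lambda>n. \<Sum>k. a n k / (b n k)\<^sup>2))"

definition coeff_cond_c :: "(nat \<Rightarrow> nat \<Rightarrow> real) \<Rightarrow> (nat \<Rightarrow> nat \<Rightarrow> real) \<Rightarrow> bool" where
  "coeff_cond_c cp cm \<longleftrightarrow>
     (\<exists>\<kappa>>0. \<forall>n M N. M \<le> N \<longrightarrow>
        \<kappa> \<le> (\<Prod>k=M..N. cp n k) \<and> (\<Prod>k=M..N. cp n k) \<le> 1 / \<kappa> \<and>
        \<kappa> \<le> (\<Prod>k=M..N. cm n k) \<and> (\<Prod>k=M..N. cm n k) \<le> 1 / \<kappa>) \<and>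
     (\<forall>n. convergent_prod (\<lambda>k. 1 / cp n k) \<and> convergent_prod (\<lambda>k. 1 / cm n k))"

text \<open>
  The Jacobi type operators as formal difference expressions on arbitrary sequences. The
  \<open>if\<close> in \<open>jacobi_A\<close> is the convention $f(-1) = 0$.
\<close>

definition jacobi_Abar ::
  "(nat \<Rightarrow> nat \<Rightarrow> real) \<Rightarrow> (nat \<Rightarrow> nat \<Rightarrow> real) \<Rightarrow> nat \<Rightarrow> (nat \<Rightarrow> complex) \<Rightarrow> nat \<Rightarrow> complex" where
  "jacobi_Abar b cp n h k =
     complex_of_real (b (n + 1) k) * (h k - complex_of_real (cp n k) * h (k + 1))"

definition jacobi_A ::
  "(nat \<Rightarrow> nat \<Rightarrow> real) \<Rightarrow> (nat \<Rightarrow> nat \<Rightarrow> real) \<Rightarrow> nat \<Rightarrow> (nat \<Rightarrow> complex) \<Rightarrow> nat \<Rightarrow> complex" where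
  "jacobi_A b cm n h k =
     complex_of_real (b n k) *
       (h k - (if k = 0 then 0 else complex_of_real (cm n (k - 1)) * h (k - 1)))"

text \<open>
  A formal series $\sum_{n\ge 0} U^n f_n^+(K) + \sum_{n\ge 1} f_n^-(K) (U^*)^n$ is encoded as a
  single family indexed by the integers: index $n \ge 0$ holds $f_n^+$ and index $-n < 0$ holds
  $f_n^-$. Thus \<open>minus_part f n\<close> is meaningful for $n \ge 1$ only.
\<close>

type_synonym series = "int \<Rightarrow> nat \<Rightarrow> complex"

definition plus_part :: "series \<Rightarrow> nat \<Rightarrow> nat \<Rightarrow> complex" where
  "plus_part f n = f (int n)"

definition minus_part :: "series \<Rightarrow> nat \<Rightarrow> nat \<Rightarrow> complex" where
  "minus_part f n = f (- int n)"

definition series_sqnorm :: "(nat \<Rightarrow> nat \<Rightarrow> real) \<Rightarrow> series \<Rightarrow> ennreal" where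
  "series_sqnorm a f =
     (\<Sum>n. \<Sum>k. ennreal (1 / a n k * (cmod (plus_part f n k))\<^sup>2)) +
     (\<Sum>n. \<Sum>k. ennreal (1 / a (Suc n) k * (cmod (minus_part f (Suc n) k))\<^sup>2))"

definition H1_space :: "(nat \<Rightarrow> nat \<Rightarrow> real) \<Rightarrow> series set" where
  "H1_space a = {f. series_sqnorm a f < \<infinity>}"

text \<open>
  Collecting coefficients in $\delta f$: the coefficient of $U^m$ for $m \ge 1$ is
  $-\overline{A}^{(m-1)} f_{m-1}^+$; that of $(U^*)^m$ for $m \ge 0$ is $A^{(m)} f_{m+1}^-$, where
  $m = 0$ is the constant term, stored as $(\delta f)_0^+$.
\<close>

definition delta ::
  "(nat \<Rightarrow> nat \<Rightarrow> real) \<Rightarrow> (nat \<Rightarrow> nat \<Rightarrow> real) \<Rightarrow> (nat \<Rightarrow> nat \<Rightarrow> real) \<Rightarrow> series \<Rightarrow> series" where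
  "delta b cp cm f m =
     (if m \<ge> 1 then (\<lambda>k. - jacobi_Abar b cp (nat (m - 1)) (plus_part f (nat (m - 1))) k)
      else jacobi_A b cm (nat (- m)) (minus_part f (nat (- m) + 1)))"

type_synonym series_pair = "series \<times> series"

definition H_space :: "(nat \<Rightarrow> nat \<Rightarrow> real) \<Rightarrow> series_pair set" where
  "H_space a = H1_space a \<times> H1_space a"

definition H_norm :: "(nat \<Rightarrow> nat \<Rightarrow> real) \<Rightarrow> series_pair \<Rightarrow> real" where
  "H_norm a x = sqrt (enn2real (series_sqnorm a (fst x)) + enn2real (series_sqnorm a (snd x)))"

definition H_scale :: "complex \<Rightarrow> series_pair \<Rightarrow> series_pair" where
  "H_scale z x = ((\<lambda>n k. z * fst x n k), (\<lambda>n k. z * snd x n k))"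

text \<open>
  The Hilbert space depends on the weights, so it is a carrier set rather than a type, and
  operators on it are functions whose behaviour outside the carrier is irrelevant. Addition and
  subtraction of pairs of series are pointwise.
\<close>

definition bounded_operator ::
  "(nat \<Rightarrow> nat \<Rightarrow> real) \<Rightarrow> (series_pair \<Rightarrow> series_pair) \<Rightarrow> bool" where
  "bounded_operator a T \<longleftrightarrow>
     (\<forall>x\<in>H_space a. T x \<in> H_space a) \<and>
     (\<forall>x\<in>H_space a. \<forall>y\<in>H_space a. T (x + y) = T x + T y) \<and>
     (\<forall>z. \<forall>x\<in>H_space a. T (H_scale z x) = H_scale z (T x)) \<and>
     (\<exists>B. \<forall>x\<in>H_space a. H_norm a (T x) \<le> B * H_norm a x)"

definition compact_operator ::
  "(nat \<Rightarrow> nat \<Rightarrow> real) \<Rightarrow> (series_pair \<Rightarrow> series_pair) \<Rightarrow> bool" where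
  "compact_operator a T \<longleftrightarrow>
     bounded_operator a T \<and>
     (\<forall>x :: nat \<Rightarrow> series_pair.
        (\<forall>i. x i \<in> H_space a) \<and> (\<exists>B. \<forall>i. H_norm a (x i) \<le> B) \<longrightarrow>
        (\<exists>r y. strict_mono r \<and> y \<in> H_space a \<and>
               (\<lambda>i. H_norm a (T (x (r i)) - y)) \<longlonglongrightarrow> 0))"

text \<open>
  The next three notions apply to an unbounded operator \<open>D\<close> in the Hilbert space with
  domain \<open>S\<close>.
\<close>

definition right_invertible ::
  "(nat \<Rightarrow> nat \<Rightarrow> real) \<Rightarrow> series_pair set \<Rightarrow> (series_pair \<Rightarrow> series_pair) \<Rightarrow> bool" where
  "right_invertible a S D \<longleftrightarrow>
     (\<exists>Q. bounded_operator a Q \<and> (\<forall>x\<in>H_space a. Q x \<in> S \<and> D (Q x) = x))"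

definition left_invertible_mod_compact ::
  "(nat \<Rightarrow> nat \<Rightarrow> real) \<Rightarrow> series_pair set \<Rightarrow> (series_pair \<Rightarrow> series_pair) \<Rightarrow> bool" where
  "left_invertible_mod_compact a S D \<longleftrightarrow>
     (\<exists>Q C. bounded_operator a Q \<and> compact_operator a C \<and> (\<forall>x\<in>S. Q (D x) = x - C x))"

definition parametrix ::
  "(nat \<Rightarrow> nat \<Rightarrow> real) \<Rightarrow> series_pair set \<Rightarrow> (series_pair \<Rightarrow> series_pair) \<Rightarrow>
   (series_pair \<Rightarrow> series_pair) \<Rightarrow> bool" where
  "parametrix a S D Q \<longleftrightarrow>
     bounded_operator a Q \<and>
     (\<forall>x\<in>H_space a. Q x \<in> S) \<and>
     (\<exists>C. compact_operator a C \<and> (\<forall>x\<in>H_space a. D (Q x) = x - C x)) \<and>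
     (\<exists>C. compact_operator a C \<and> (\<forall>x\<in>S. Q (D x) = x - C x))"

definition dirac ::
  "(nat \<Rightarrow> nat \<Rightarrow> real) \<Rightarrow> (nat \<Rightarrow> nat \<Rightarrow> real) \<Rightarrow> (nat \<Rightarrow> nat \<Rightarrow> real) \<Rightarrow>
   series_pair \<Rightarrow> series_pair" where
  "dirac b cp cm x = (delta b cp cm (fst x), delta b cp cm (snd x))"

text \<open>
  Here \<open>lim h\<close> is $h(\infty)$. Under the coefficient conditions the limits
  occurring below exist for all series \<open>f\<close>, \<open>g\<close> satisfying the membership and norm conditions.
\<close>

definition dirac_dom ::
  "(nat \<Rightarrow> nat \<Rightarrow> real) \<Rightarrow> (nat \<Rightarrow> nat \<Rightarrow> real) \<Rightarrow> (nat \<Rightarrow> nat \<Rightarrow> real) \<Rightarrow> (nat \<Rightarrow> nat \<Rightarrow> real) \<Rightarrow>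
   series_pair set" where
  "dirac_dom a b cp cm =
     {(f, g) \<in> H_space a.
        series_sqnorm a (delta b cp cm f) < \<infinity> \<and>
        series_sqnorm a (delta b cp cm g) < \<infinity> \<and>
        lim (plus_part f 0) = lim (plus_part g 0) \<and>
        (\<forall>n\<ge>1. lim (plus_part f n) = lim (minus_part g n) \<and>
               lim (minus_part f n) = lim (plus_part g n))}"

end

theory Submission
  imports Defs "HOL-Complex_Analysis.Great_Picard"
begin

text \<open>
  Index the coefficients of a series by the integers, as in \<open>series\<close>. Then $\delta$ shifts
  the index by one: $(\delta f)_{m+1}$ is a first order difference expression in $f_m$. After
  multiplication by an integrating factor (\<open>gauge\<close>), built from partial products of $c_\pm$ and hence
  bounded above and away from zero, it becomes an ordinary difference, so that $\delta f = p$
  is solved by summation (\<open>eq_block_solution_delta\<close>, \<open>delta_eqI_block_solution\<close>). The sums converge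
  by the Cauchy-Schwarz inequality and $t(n) < \infty$. For $m < 0$ the solution is unique. For
  $m \ge 0$ one constant is free, and it is used up by the boundary condition: the limit of $f_m$ must
  equal that of $g_{-m}$, and vice versa. Only at $m = 0$, where $f_0$ and $g_0$ are coupled to each
  other, does one free constant $z = f_0^+(0)$ remain. Thus the pairs in the domain of $D$ that $D$
  maps to $y$ are exactly the pairs \<open>solution z y\<close>, which are linear in $(z, y)$.

  Put $Q y$ = \<open>solution 0 y\<close>. Then $D Q = I$, and
  $Q D x = x - C x$ for $x$ in the domain, where $C x$ = \<open>solution z 0\<close> with
  $z$ the value $f_0^+(0)$ of $x = (f, g)$. So $C$ has rank one, and this one operator $Q$ is a right
  inverse, a left inverse modulo compact operators and a parametrix.

  It remains to see that $Q$ and $C$ are compact (\<open>compact_operatorI_levelwise\<close>).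
  The coefficients of $Q y$ at level $n$ are bounded, uniformly in $k$, by a
  constant times the norm of $y$ at the levels $n \pm 1$, because $t(n)$ is bounded
  (\<open>solution_levelwise\<close>). Hence the norm of $Q y$ at level $n$ gains a factor
  $s(n)^{1/2}$, and $s(n) \to 0$ makes the tails of $Q y$ uniformly small for bounded $y$. On finitely many
  levels a pointwise bound gives relative compactness in the weighted $\ell^2$ space by
  dominated convergence.
\<close>

section \<open>Relative compactness in weighted square-summable spaces\<close>

lemma cmod_diff_sq_le: "(cmod (x - y))\<^sup>2 \<le> 2 * (cmod x)\<^sup>2 + 2 * (cmod y)\<^sup>2"
proof -
  have "(cmod (x - y))\<^sup>2 \<le> (cmod x + cmod y)\<^sup>2"
    by (intro power_mono norm_triangle_ineq4) auto
  also have "\<dots> \<le> 2 * (cmod x)\<^sup>2 + 2 * (cmod y)\<^sup>2"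
    using zero_le_power2[of "cmod x - cmod y"] by (simp add: power2_sum power2_diff)
  finally show ?thesis .
qed

lemma tendsto_0_ennrealI:
  fixes F :: "nat \<Rightarrow> ennreal"
  assumes "\<And>\<epsilon>::real. \<epsilon> > 0 \<Longrightarrow> eventually (\<lambda>i. F i < ennreal \<epsilon>) sequentially"
  shows "F \<longlonglongrightarrow> 0"
proof (rule order_tendstoI)
  fix x :: ennreal assume "0 < x"
  then obtain \<epsilon> where e: "\<epsilon> > 0" "ennreal \<epsilon> \<le> x"
    by (cases x) (auto intro: that[of 1])
  from assms[OF e(1)] show "eventually (\<lambda>i. F i < x) sequentially"
    by eventually_elim (use e in auto)
qed auto

text \<open>
  A sequence in a weighted $\ell^2$ space that is uniformly bounded pointwise and uniformly small
  off sets of finite total weight has a norm convergent subsequence. A diagonal argument gives a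
  pointwise convergent subsequence; on the set of finite weight dominated convergence applies, and
  off it Fatou's lemma shows that the limit is as small as the sequence.
\<close>

lemma weighted_l2_relatively_compact:
  fixes w :: "'i::countable \<Rightarrow> real" and f :: "nat \<Rightarrow> 'i \<Rightarrow> complex"
  assumes w: "\<And>z. 0 \<le> w z"
    and bdd: "\<And>i z. cmod (f i z) \<le> M"
    and tails: "\<And>\<epsilon>::real. \<epsilon> > 0 \<Longrightarrow>
        \<exists>A. (\<integral>\<^sup>+z\<in>A. ennreal (w z) \<partial>count_space UNIV) < \<infinity> \<and>
            (\<forall>i. (\<integral>\<^sup>+z\<in>-A. ennreal (w z * (cmod (f i z))\<^sup>2) \<partial>count_space UNIV) \<le> ennreal \<epsilon>)"
  obtains r g where "strict_mono (r :: nat \<Rightarrow> nat)"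
    and "(\<integral>\<^sup>+z. ennreal (w z * (cmod (g z))\<^sup>2) \<partial>count_space UNIV) < \<infinity>"
    and "(\<lambda>i. \<integral>\<^sup>+z. ennreal (w z * (cmod (f (r i) z - g z))\<^sup>2) \<partial>count_space UNIV) \<longlonglongrightarrow> 0"
proof -
  obtain r :: "nat \<Rightarrow> nat" where r: "strict_mono r"
    and ex: "\<And>z. z \<in> UNIV \<Longrightarrow> \<exists>l. (\<lambda>n. f (r n) z) \<longlonglongrightarrow> l"
    using function_convergent_subsequence[of UNIV f M] bdd by (metis countableI_type)
  then obtain g where g: "\<And>z. (\<lambda>n. f (r n) z) \<longlonglongrightarrow> g z" by (metis UNIV_I)
  have gM: "cmod (g z) \<le> M" for z
    by (rule LIMSEQ_le_const2[OF tendsto_norm[OF g]]) (use bdd in auto)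
  have tail_g: "(\<integral>\<^sup>+z\<in>-A. ennreal (w z * (cmod (g z))\<^sup>2) \<partial>count_space UNIV) \<le> ennreal \<epsilon>"
    if A: "\<forall>i. (\<integral>\<^sup>+z\<in>-A. ennreal (w z * (cmod (f i z))\<^sup>2) \<partial>count_space UNIV) \<le> ennreal \<epsilon>"
    for A \<epsilon>
  proof -
    have lim: "(\<lambda>n. ennreal (w z * (cmod (f (r n) z))\<^sup>2) * indicator (-A) z)
        \<longlonglongrightarrow> ennreal (w z * (cmod (g z))\<^sup>2) * indicator (-A) z" for z
      by (cases "z \<in> A") (auto intro!: tendsto_intros g)
    have "(\<integral>\<^sup>+z\<in>-A. ennreal (w z * (cmod (g z))\<^sup>2) \<partial>count_space UNIV)
      = (\<integral>\<^sup>+z. liminf (\<lambda>n. ennreal (w z * (cmod (f (r n) z))\<^sup>2) * indicator (-A) z) \<partial>count_space UNIV)"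
      by (intro nn_integral_cong) (metis lim lim_imp_Liminf trivial_limit_sequentially)
    also have "\<dots> \<le> liminf (\<lambda>n. \<integral>\<^sup>+z\<in>-A. ennreal (w z * (cmod (f (r n) z))\<^sup>2) \<partial>count_space UNIV)"
      by (rule nn_integral_liminf) auto
    also have "\<dots> \<le> ennreal \<epsilon>"
      by (rule Liminf_le) (use A in auto)
    finally show ?thesis .
  qed
  have split: "(\<integral>\<^sup>+z. h z \<partial>count_space UNIV) =
      (\<integral>\<^sup>+z\<in>A. h z \<partial>count_space UNIV) + (\<integral>\<^sup>+z\<in>-A. h z \<partial>count_space UNIV)"
    for h :: "'i \<Rightarrow> ennreal" and A
    using nn_integral_disjoint_pair_countspace[of A "-A" h] by simp
  show ?thesis
  proof (rule that[OF r])
    obtain A where A: "(\<integral>\<^sup>+z\<in>A. ennreal (w z) \<partial>count_space UNIV) < \<infinity>"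
      "\<forall>i. (\<integral>\<^sup>+z\<in>-A. ennreal (w z * (cmod (f i z))\<^sup>2) \<partial>count_space UNIV) \<le> ennreal 1"
      using tails[of 1] by auto
    have "w z * (cmod (g z))\<^sup>2 \<le> M\<^sup>2 * w z" for z
      using mult_right_mono[OF power_mono[OF gM norm_ge_zero, of z 2] w[of z]] by (simp add: mult.commute)
    then have "(\<integral>\<^sup>+z\<in>A. ennreal (w z * (cmod (g z))\<^sup>2) \<partial>count_space UNIV)
        \<le> (\<integral>\<^sup>+z. ennreal (M\<^sup>2) * (ennreal (w z) * indicator A z) \<partial>count_space UNIV)"
      by (intro nn_integral_mono)
        (simp add: indicator_def ennreal_mult'[symmetric] ennreal_leI)
    also have "\<dots> = ennreal (M\<^sup>2) * (\<integral>\<^sup>+z\<in>A. ennreal (w z) \<partial>count_space UNIV)"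
      by (rule nn_integral_cmult) auto
    also have "\<dots> < \<infinity>" using A(1) by (simp add: ennreal_mult_less_top)
    finally show "(\<integral>\<^sup>+z. ennreal (w z * (cmod (g z))\<^sup>2) \<partial>count_space UNIV) < \<infinity>"
      using le_less_trans[OF tail_g[OF A(2)] ennreal_less_top]
      by (subst split[of _ A]) (simp only: infinity_ennreal_def ennreal_add_less_top)
  next
    show "(\<lambda>i. \<integral>\<^sup>+z. ennreal (w z * (cmod (f (r i) z - g z))\<^sup>2) \<partial>count_space UNIV) \<longlonglongrightarrow> 0"
    proof (rule tendsto_0_ennrealI)
      fix \<epsilon>' :: real assume "\<epsilon>' > 0"
      define \<epsilon> where "\<epsilon> = \<epsilon>' / 6"
      have \<epsilon>: "\<epsilon> > 0" using \<open>\<epsilon>' > 0\<close> by (simp add: \<epsilon>_def)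
      obtain A where A: "(\<integral>\<^sup>+z\<in>A. ennreal (w z) \<partial>count_space UNIV) < \<infinity>"
        "\<forall>i. (\<integral>\<^sup>+z\<in>-A. ennreal (w z * (cmod (f i z))\<^sup>2) \<partial>count_space UNIV) \<le> ennreal \<epsilon>"
        using tails[OF \<epsilon>] by auto
      have "(\<lambda>i. \<integral>\<^sup>+z\<in>A. ennreal (w z * (cmod (f (r i) z - g z))\<^sup>2) \<partial>count_space UNIV)
          \<longlonglongrightarrow> (\<integral>\<^sup>+z. 0 \<partial>count_space (UNIV :: 'i set))"
      proof (rule nn_integral_dominated_convergence
              [where w = "\<lambda>z. ennreal ((2 * M)\<^sup>2) * (ennreal (w z) * indicator A z)"])
        fix i
        have "w z * (cmod (f (r i) z - g z))\<^sup>2 \<le> (2 * M)\<^sup>2 * w z" for z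
        proof -
          have "cmod (f (r i) z - g z) \<le> 2 * M"
            using norm_triangle_ineq4[of "f (r i) z" "g z"] bdd[of "r i" z] gM[of z] by linarith
          then show ?thesis
            using mult_right_mono[OF power_mono[OF _ norm_ge_zero, of _ "2 * M" 2] w[of z]]
            by (simp add: mult.commute)
        qed
        then show "AE z in count_space UNIV. ennreal (w z * (cmod (f (r i) z - g z))\<^sup>2) * indicator A z
            \<le> ennreal ((2 * M)\<^sup>2) * (ennreal (w z) * indicator A z)"
          by (intro AE_I2) (simp add: indicator_def ennreal_mult'[symmetric] ennreal_leI)
      next
        have "(\<integral>\<^sup>+z. ennreal ((2 * M)\<^sup>2) * (ennreal (w z) * indicator A z) \<partial>count_space UNIV)
          = ennreal ((2 * M)\<^sup>2) * (\<integral>\<^sup>+z\<in>A. ennreal (w z) \<partial>count_space UNIV)"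
          by (rule nn_integral_cmult) auto
        then show "(\<integral>\<^sup>+z. ennreal ((2 * M)\<^sup>2) * (ennreal (w z) * indicator A z) \<partial>count_space UNIV) < \<infinity>"
          using A(1) by (simp add: ennreal_mult_less_top)
      next
        have "(\<lambda>i. ennreal (w z * (cmod (f (r i) z - g z))\<^sup>2)) \<longlonglongrightarrow> ennreal (w z * (cmod (g z - g z))\<^sup>2)" for z
          by (intro tendsto_intros g)
        then show "AE z in count_space UNIV.
            (\<lambda>i. ennreal (w z * (cmod (f (r i) z - g z))\<^sup>2) * indicator A z) \<longlonglongrightarrow> 0"
          by (intro AE_I2) (auto simp: indicator_def)
      qed auto
      then have ev: "eventually (\<lambda>i. (\<integral>\<^sup>+z\<in>A. ennreal (w z * (cmod (f (r i) z - g z))\<^sup>2) \<partial>count_space UNIV)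
          < ennreal \<epsilon>) sequentially"
        using \<epsilon> by (intro order_tendstoD(2)) auto
      have tail: "(\<integral>\<^sup>+z\<in>-A. ennreal (w z * (cmod (f i z - g z))\<^sup>2) \<partial>count_space UNIV) \<le> ennreal (4 * \<epsilon>)" for i
      proof -
        have "(\<integral>\<^sup>+z\<in>-A. ennreal (w z * (cmod (f i z - g z))\<^sup>2) \<partial>count_space UNIV)
          \<le> (\<integral>\<^sup>+z. 2 * (ennreal (w z * (cmod (f i z))\<^sup>2) * indicator (-A) z)
                + 2 * (ennreal (w z * (cmod (g z))\<^sup>2) * indicator (-A) z) \<partial>count_space UNIV)"
        proof (rule nn_integral_mono)
          fix z
          have "w z * (cmod (f i z - g z))\<^sup>2 \<le> w z * (2 * (cmod (f i z))\<^sup>2 + 2 * (cmod (g z))\<^sup>2)"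
            by (intro mult_left_mono cmod_diff_sq_le w)
          then have "ennreal (w z * (cmod (f i z - g z))\<^sup>2)
              \<le> ennreal (2 * (w z * (cmod (f i z))\<^sup>2) + 2 * (w z * (cmod (g z))\<^sup>2))"
            by (intro ennreal_leI) (simp add: algebra_simps)
          also have "\<dots> = 2 * ennreal (w z * (cmod (f i z))\<^sup>2) + 2 * ennreal (w z * (cmod (g z))\<^sup>2)"
            using w[of z] by (simp add: ennreal_plus ennreal_mult'' ennreal_mult)
          finally show "ennreal (w z * (cmod (f i z - g z))\<^sup>2) * indicator (-A) z \<le>
              2 * (ennreal (w z * (cmod (f i z))\<^sup>2) * indicator (-A) z)
                + 2 * (ennreal (w z * (cmod (g z))\<^sup>2) * indicator (-A) z)"
            by (auto simp: indicator_def)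
        qed
        also have "\<dots> = 2 * (\<integral>\<^sup>+z\<in>-A. ennreal (w z * (cmod (f i z))\<^sup>2) \<partial>count_space UNIV)
            + 2 * (\<integral>\<^sup>+z\<in>-A. ennreal (w z * (cmod (g z))\<^sup>2) \<partial>count_space UNIV)"
          by (simp add: nn_integral_add nn_integral_cmult)
        also have "\<dots> \<le> 2 * ennreal \<epsilon> + 2 * ennreal \<epsilon>"
          using A(2) tail_g[OF A(2)] by (intro add_mono mult_left_mono) auto
        also have "\<dots> = ennreal (2 * \<epsilon> + 2 * \<epsilon>)"
          using \<epsilon> by (simp add: ennreal_mult flip: distrib_right)
        finally show ?thesis by simp
      qed
      show "eventually (\<lambda>i. (\<integral>\<^sup>+z. ennreal (w z * (cmod (f (r i) z - g z))\<^sup>2) \<partial>count_space UNIV) < ennreal \<epsilon>') sequentially"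
        using ev
      proof eventually_elim
        case (elim i)
        have "ennreal (4 * \<epsilon>) < ennreal (5 * \<epsilon>)" using \<epsilon> by (simp add: ennreal_lessI)
        then have "(\<integral>\<^sup>+z. ennreal (w z * (cmod (f (r i) z - g z))\<^sup>2) \<partial>count_space UNIV) < ennreal (\<epsilon> + 5 * \<epsilon>)"
          by (subst split[of _ A], intro add_mono_ennreal[OF elim] order.strict_trans1[OF tail])
        then show ?case by (simp add: \<epsilon>_def)
      qed
    qed
  qed
qed

section \<open>Series whose levels are bounded pointwise\<close>

lemma nn_integral_count_space_int:
  fixes h :: "int \<Rightarrow> ennreal"
  shows "(\<integral>\<^sup>+m. h m \<partial>count_space UNIV) = (\<Sum>n. h (int n)) + (\<Sum>n. h (- int (Suc n)))"
proof -
  have inj: "inj int" "inj (\<lambda>n. - int (Suc n))"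
    by (auto simp: inj_def)
  have r: "range int \<inter> range (\<lambda>n. - int (Suc n)) = {}"
    "range int \<union> range (\<lambda>n. - int (Suc n)) = UNIV"
  proof -
    show "range int \<inter> range (\<lambda>n. - int (Suc n)) = {}" by auto
    have "m \<in> range int \<union> range (\<lambda>n. - int (Suc n))" for m
      by (cases m rule: int_cases) blast+
    then show "range int \<union> range (\<lambda>n. - int (Suc n)) = UNIV" by blast
  qed
  have "(\<integral>\<^sup>+m. h m \<partial>count_space UNIV) =
      (\<integral>\<^sup>+m\<in>range int \<union> range (\<lambda>n. - int (Suc n)). h m \<partial>count_space UNIV)"
    unfolding r by simp
  also have "\<dots> = (\<integral>\<^sup>+m\<in>range int. h m \<partial>count_space UNIV)
      + (\<integral>\<^sup>+m\<in>range (\<lambda>n. - int (Suc n)). h m \<partial>count_space UNIV)"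
    by (rule nn_integral_disjoint_pair_countspace[OF r(1)])
  also have "\<dots> = (\<integral>\<^sup>+n. h (int n) \<partial>count_space UNIV) + (\<integral>\<^sup>+n. h (- int (Suc n)) \<partial>count_space UNIV)"
    using nn_integral_count_compose_inj[OF inj(1), of h] nn_integral_count_compose_inj[OF inj(2), of h]
    by simp
  finally show ?thesis
    by (simp only: nn_integral_count_space_nat)
qed

lemma series_sqnorm_eq_nn_integral:
  "series_sqnorm a f =
    (\<integral>\<^sup>+z. ennreal (1 / a (nat \<bar>fst z\<bar>) (snd z) * (cmod (f (fst z) (snd z)))\<^sup>2) \<partial>count_space UNIV)"
  by (subst nn_integral_fst_count_space[symmetric])
    (simp add: nn_integral_count_space_int nn_integral_count_space_nat series_sqnorm_def
      plus_part_def minus_part_def nat_add_distrib del: of_nat_Suc)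

text \<open>
  Each level $n \ge 1$ is met by the two integers $\pm n$, whence the factor 2.
\<close>

lemma nn_integral_level_le:
  fixes e :: "nat \<Rightarrow> real"
  assumes "\<And>n. 0 \<le> e n" "\<And>n. (\<Sum>i<n. e i) \<le> M"
  shows "(\<integral>\<^sup>+m. ennreal (e (nat \<bar>m\<bar>)) \<partial>count_space UNIV) \<le> ennreal (2 * M)"
proof -
  have M: "0 \<le> M" using assms(2)[of 0] by simp
  have 1: "(\<Sum>n. ennreal (e n)) \<le> ennreal M"
    using assms by (intro suminf_le_const summableI) (simp add: ennreal_leI)
  have "(\<Sum>i<n. e (Suc i)) \<le> M" for n
    using assms(2)[of "Suc n"] assms(1)[of 0] by (simp only: sum.lessThan_Suc_shift)
  then have 2: "(\<Sum>n. ennreal (e (Suc n))) \<le> ennreal M"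
    using assms by (intro suminf_le_const summableI) (simp add: ennreal_leI)
  have "(\<integral>\<^sup>+m. ennreal (e (nat \<bar>m\<bar>)) \<partial>count_space UNIV) = (\<Sum>n. ennreal (e n)) + (\<Sum>n. ennreal (e (Suc n)))"
    by (simp only: nn_integral_count_space_int abs_minus_cancel abs_of_nat nat_int)
  also have "\<dots> \<le> ennreal M + ennreal M" by (intro add_mono 1 2)
  also have "\<dots> = ennreal (2 * M)" using M by (simp flip: ennreal_plus)
  finally show ?thesis .
qed

text \<open>
  A pointwise bound on the coefficients of a level costs only the factor
  $s(n) = \sum_k 1/a^{(n)}(k)$ when it is turned into a bound on the norm of that level.
\<close>

lemma tail_sqnorm_le:
  fixes f :: series
  assumes a: "coeff_cond_a a"
    and e: "\<And>n. 0 \<le> e n" "\<And>n. (\<Sum>i<n. e i) \<le> M"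
    and f: "\<And>m k. (cmod (f m k))\<^sup>2 \<le> e (nat \<bar>m\<bar>)"
    and \<sigma>: "0 \<le> \<sigma>" "\<And>n. N \<le> n \<Longrightarrow> (\<Sum>k. 1 / a n k) \<le> \<sigma>"
  shows "(\<integral>\<^sup>+z\<in>{z. N \<le> nat \<bar>fst z\<bar>}.
           ennreal (1 / a (nat \<bar>fst z\<bar>) (snd z) * (cmod (f (fst z) (snd z)))\<^sup>2) \<partial>count_space UNIV)
         \<le> ennreal (2 * \<sigma> * M)"
proof -
  have a_pos: "a n k > 0" and a_sum: "summable (\<lambda>k. 1 / a n k)" for n k
    using a by (auto simp: coeff_cond_a_def)
  let ?h = "\<lambda>m k. ennreal (1 / a (nat \<bar>m\<bar>) k * (cmod (f m k))\<^sup>2) * indicator {z. N \<le> nat \<bar>fst z\<bar>} (m, k)"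
  have inner: "(\<integral>\<^sup>+k. ?h m k \<partial>count_space UNIV) \<le> ennreal \<sigma> * ennreal (e (nat \<bar>m\<bar>))" for m
  proof (cases "N \<le> nat \<bar>m\<bar>")
    case True
    have "(\<integral>\<^sup>+k. ?h m k \<partial>count_space UNIV)
        \<le> (\<integral>\<^sup>+k. ennreal (1 / a (nat \<bar>m\<bar>) k) * ennreal (e (nat \<bar>m\<bar>)) \<partial>count_space UNIV)"
    proof (rule nn_integral_mono)
      fix k
      have "1 / a (nat \<bar>m\<bar>) k * (cmod (f m k))\<^sup>2 \<le> 1 / a (nat \<bar>m\<bar>) k * e (nat \<bar>m\<bar>)"
        using f[of m k] a_pos[of "nat \<bar>m\<bar>" k] by (intro mult_left_mono) auto
      then have "ennreal (1 / a (nat \<bar>m\<bar>) k * (cmod (f m k))\<^sup>2) \<le> ennreal (1 / a (nat \<bar>m\<bar>) k * e (nat \<bar>m\<bar>))"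
        by (rule ennreal_leI)
      also have "\<dots> = ennreal (1 / a (nat \<bar>m\<bar>) k) * ennreal (e (nat \<bar>m\<bar>))"
        using a_pos[of "nat \<bar>m\<bar>" k] e(1) by (intro ennreal_mult) auto
      finally show "?h m k \<le> ennreal (1 / a (nat \<bar>m\<bar>) k) * ennreal (e (nat \<bar>m\<bar>))"
        using True by simp
    qed
    also have "\<dots> = (\<Sum>k. ennreal (1 / a (nat \<bar>m\<bar>) k)) * ennreal (e (nat \<bar>m\<bar>))"
      by (simp only: nn_integral_count_space_nat ennreal_suminf_multc)
    also have "(\<Sum>k. ennreal (1 / a (nat \<bar>m\<bar>) k)) = ennreal (\<Sum>k. 1 / a (nat \<bar>m\<bar>) k)"
      using a_pos a_sum by (intro suminf_ennreal2) (auto intro: less_imp_le)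
    also have "ennreal (\<Sum>k. 1 / a (nat \<bar>m\<bar>) k) * ennreal (e (nat \<bar>m\<bar>)) \<le> ennreal \<sigma> * ennreal (e (nat \<bar>m\<bar>))"
      by (intro mult_right_mono ennreal_leI \<sigma>(2) True) auto
    finally show ?thesis .
  qed simp
  have "(\<integral>\<^sup>+z\<in>{z. N \<le> nat \<bar>fst z\<bar>}.
           ennreal (1 / a (nat \<bar>fst z\<bar>) (snd z) * (cmod (f (fst z) (snd z)))\<^sup>2) \<partial>count_space UNIV)
      = (\<integral>\<^sup>+m. \<integral>\<^sup>+k. ?h m k \<partial>count_space UNIV \<partial>count_space UNIV)"
    by (subst nn_integral_fst_count_space[symmetric]) simp
  also have "\<dots> \<le> (\<integral>\<^sup>+m. ennreal \<sigma> * ennreal (e (nat \<bar>m\<bar>)) \<partial>count_space UNIV)"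
    by (intro nn_integral_mono inner)
  also have "\<dots> = ennreal \<sigma> * (\<integral>\<^sup>+m. ennreal (e (nat \<bar>m\<bar>)) \<partial>count_space UNIV)"
    by (rule nn_integral_cmult) auto
  also have "\<dots> \<le> ennreal \<sigma> * ennreal (2 * M)"
    by (intro mult_left_mono nn_integral_level_le e) auto
  also have "\<dots> = ennreal (2 * \<sigma> * M)"
    using \<sigma>(1) by (simp add: mult_ac flip: ennreal_mult')
  finally show ?thesis .
qed

lemma coeff_cond_a_sum_bounded:
  assumes "coeff_cond_a a"
  obtains \<sigma> where "0 \<le> \<sigma>" "\<And>n. (\<Sum>k. 1 / a n k) \<le> \<sigma>"
proof -
  have "Bseq (\<lambda>n. \<Sum>k. 1 / a n k)"
    using assms by (auto simp: coeff_cond_a_def intro!: convergent_imp_Bseq convergentI)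
  then obtain \<sigma> where "\<sigma> > 0" "\<And>n. norm (\<Sum>k. 1 / a n k) \<le> \<sigma>"
    by (auto simp: Bseq_def)
  then show ?thesis
    by (intro that[of \<sigma>]) (auto simp: abs_le_iff)
qed

lemma series_sqnorm_le:
  fixes f :: series
  assumes a: "coeff_cond_a a"
    and e: "\<And>n. 0 \<le> e n" "\<And>n. (\<Sum>i<n. e i) \<le> M"
    and f: "\<And>m k. (cmod (f m k))\<^sup>2 \<le> e (nat \<bar>m\<bar>)"
    and \<sigma>: "0 \<le> \<sigma>" "\<And>n. (\<Sum>k. 1 / a n k) \<le> \<sigma>"
  shows "series_sqnorm a f \<le> ennreal (2 * \<sigma> * M)"
  using tail_sqnorm_le[OF a e f \<sigma>(1), of 0] \<sigma>(2)
  by (simp add: series_sqnorm_eq_nn_integral)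

text \<open>
  Here $s(n) \to 0$ makes the tails uniformly small.
\<close>

lemma levelwise_bounded_relatively_compact:
  fixes f :: "nat \<Rightarrow> series"
  assumes a: "coeff_cond_a a"
    and e: "\<And>i n. 0 \<le> e i n" "\<And>i n. (\<Sum>j<n. e i j) \<le> M"
    and f: "\<And>i m k. (cmod (f i m k))\<^sup>2 \<le> e i (nat \<bar>m\<bar>)"
  obtains r g where "strict_mono (r :: nat \<Rightarrow> nat)" "g \<in> H1_space a"
    "(\<lambda>i. series_sqnorm a (f (r i) - g)) \<longlonglongrightarrow> 0"
proof -
  define w where "w = (\<lambda>z::int \<times> nat. 1 / a (nat \<bar>fst z\<bar>) (snd z))"
  have a_pos: "a n k > 0" for n k using a by (auto simp: coeff_cond_a_def)
  have M: "0 \<le> M" using e(2)[of 0 0] by simp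
  have eM: "e i n \<le> M" for i n
  proof -
    have "e i n \<le> (\<Sum>j<Suc n. e i j)" using e(1) by (intro member_le_sum) auto
    then show ?thesis using e(2)[of i "Suc n"] by linarith
  qed
  obtain r g where r: "strict_mono (r :: nat \<Rightarrow> nat)"
    and g: "(\<integral>\<^sup>+z. ennreal (w z * (cmod (g z))\<^sup>2) \<partial>count_space UNIV) < \<infinity>"
    and lim: "(\<lambda>i. \<integral>\<^sup>+z. ennreal (w z * (cmod (f (r i) (fst z) (snd z) - g z))\<^sup>2) \<partial>count_space UNIV) \<longlonglongrightarrow> 0"
  proof (rule weighted_l2_relatively_compact[of w "\<lambda>i z. f i (fst z) (snd z)" "sqrt M"])
    show "0 \<le> w z" for z using a_pos by (simp add: w_def less_imp_le)
    show "cmod (f i (fst z) (snd z)) \<le> sqrt M" for i z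
      by (rule real_le_rsqrt) (rule order_trans[OF f eM])
    fix \<epsilon> :: real assume \<epsilon>: "\<epsilon> > 0"
    define \<sigma> where "\<sigma> = \<epsilon> / (2 * M + 1)"
    have \<sigma>: "\<sigma> > 0" "2 * \<sigma> * M \<le> \<epsilon>"
      using \<epsilon> M by (auto simp: \<sigma>_def field_simps)
    have "eventually (\<lambda>n. (\<Sum>k. 1 / a n k) < \<sigma>) sequentially"
      using a \<sigma>(1) by (intro order_tendstoD(2)) (auto simp: coeff_cond_a_def)
    then obtain N where N: "\<And>n. N \<le> n \<Longrightarrow> (\<Sum>k. 1 / a n k) \<le> \<sigma>"
      by (auto simp: eventually_sequentially intro: less_imp_le)
    define A where "A = {z::int \<times> nat. nat \<bar>fst z\<bar> < N}"
    have "- A = {z. N \<le> nat \<bar>fst z\<bar>}" by (auto simp: A_def)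
    then have tail: "(\<integral>\<^sup>+z\<in>-A. ennreal (w z * (cmod (f i (fst z) (snd z)))\<^sup>2) \<partial>count_space UNIV) \<le> ennreal \<epsilon>" for i
      using order_trans[OF tail_sqnorm_le[OF a e f less_imp_le[OF \<sigma>(1)] N] ennreal_leI[OF \<sigma>(2)]]
      by (simp add: w_def)
    obtain \<sigma>' where \<sigma>': "0 \<le> \<sigma>'" "\<And>n. (\<Sum>k. 1 / a n k) \<le> \<sigma>'"
      using coeff_cond_a_sum_bounded[OF a] by blast
    \<comment> \<open>The total weight of the first \<open>N\<close> levels is the norm of their indicator.\<close>
    have "(\<integral>\<^sup>+z\<in>A. ennreal (w z) \<partial>count_space UNIV)
        = series_sqnorm a (\<lambda>m k. if nat \<bar>m\<bar> < N then 1 else 0)"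
      unfolding series_sqnorm_eq_nn_integral
      by (intro nn_integral_cong) (auto simp: A_def w_def)
    also have "\<dots> \<le> ennreal (2 * \<sigma>' * real N)"
    proof (rule series_sqnorm_le[OF a _ _ _ \<sigma>', where e = "\<lambda>n. if n < N then 1 else 0"])
      fix n
      have "(\<Sum>i<n. if i < N then 1 else 0 :: real) = real (card ({..<n} \<inter> {i. i < N}))"
        by (simp add: sum.If_cases)
      also have "card ({..<n} \<inter> {i. i < N}) \<le> card {..<N}"
        by (intro card_mono) auto
      finally show "(\<Sum>i<n. if i < N then 1 else 0 :: real) \<le> real N" by simp
    qed auto
    also have "\<dots> < \<infinity>" by simp
    finally show "\<exists>A. (\<integral>\<^sup>+z\<in>A. ennreal (w z) \<partial>count_space UNIV) < \<infinity> \<and>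
        (\<forall>i. (\<integral>\<^sup>+z\<in>-A. ennreal (w z * (cmod (f i (fst z) (snd z)))\<^sup>2) \<partial>count_space UNIV) \<le> ennreal \<epsilon>)"
      using tail by blast
  qed
  show ?thesis
  proof (rule that[OF r, of "\<lambda>m k. g (m, k)"])
    show "(\<lambda>m k. g (m, k)) \<in> H1_space a"
      using g by (simp add: H1_space_def series_sqnorm_eq_nn_integral w_def)
    show "(\<lambda>i. series_sqnorm a (f (r i) - (\<lambda>m k. g (m, k)))) \<longlonglongrightarrow> 0"
      using lim by (simp add: series_sqnorm_eq_nn_integral w_def)
  qed
qed

section \<open>A criterion for compact operators\<close>

lemma H_norm_nonneg: "0 \<le> H_norm a x"
  by (simp add: H_norm_def)

lemma H_norm_sq: "(H_norm a x)\<^sup>2 = enn2real (series_sqnorm a (fst x)) + enn2real (series_sqnorm a (snd x))"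
  by (simp add: H_norm_def)

text \<open>
  A linear operator is compact as soon as it maps $x$ to a pair of series whose squared coefficients at
  level $n$ are bounded, uniformly in $k$, by numbers $e_n$ with $\sum_n e_n \le K \|x\|^2$.
\<close>

lemma compact_operatorI_levelwise:
  assumes a: "coeff_cond_a a"
    and add: "\<And>x y. x \<in> H_space a \<Longrightarrow> y \<in> H_space a \<Longrightarrow> T (x + y) = T x + T y"
    and scale: "\<And>z x. x \<in> H_space a \<Longrightarrow> T (H_scale z x) = H_scale z (T x)"
    and K: "0 \<le> K"
    and est: "\<And>x. x \<in> H_space a \<Longrightarrow> \<exists>e. (\<forall>n. 0 \<le> e n) \<and> (\<forall>n. (\<Sum>j<n. e j) \<le> K * (H_norm a x)\<^sup>2) \<and>
       (\<forall>m k. (cmod (fst (T x) m k))\<^sup>2 \<le> e (nat \<bar>m\<bar>) \<and> (cmod (snd (T x) m k))\<^sup>2 \<le> e (nat \<bar>m\<bar>))"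
  shows "compact_operator a T"
proof -
  have "\<forall>x\<in>H_space a. \<exists>e. (\<forall>n. 0 \<le> e n) \<and> (\<forall>n. (\<Sum>j<n. e j) \<le> K * (H_norm a x)\<^sup>2) \<and>
       (\<forall>m k. (cmod (fst (T x) m k))\<^sup>2 \<le> e (nat \<bar>m\<bar>) \<and> (cmod (snd (T x) m k))\<^sup>2 \<le> e (nat \<bar>m\<bar>))"
    using est by blast
  then obtain e where all: "\<forall>x\<in>H_space a. (\<forall>n. 0 \<le> e x n) \<and> (\<forall>n. (\<Sum>j<n. e x j) \<le> K * (H_norm a x)\<^sup>2) \<and>
       (\<forall>m k. (cmod (fst (T x) m k))\<^sup>2 \<le> e x (nat \<bar>m\<bar>) \<and> (cmod (snd (T x) m k))\<^sup>2 \<le> e x (nat \<bar>m\<bar>))"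
    by (rule bchoice[THEN exE])
  have e: "0 \<le> e x n" "(\<Sum>j<n. e x j) \<le> K * (H_norm a x)\<^sup>2"
      "(cmod (fst (T x) m k))\<^sup>2 \<le> e x (nat \<bar>m\<bar>)" "(cmod (snd (T x) m k))\<^sup>2 \<le> e x (nat \<bar>m\<bar>)"
    if "x \<in> H_space a" for x n m k
    using bspec[OF all that] by blast+
  obtain \<sigma> where \<sigma>: "0 \<le> \<sigma>" "\<And>n. (\<Sum>k. 1 / a n k) \<le> \<sigma>"
    using coeff_cond_a_sum_bounded[OF a] by blast
  have nrm: "series_sqnorm a (fst (T x)) \<le> ennreal (2 * \<sigma> * (K * (H_norm a x)\<^sup>2))"
    "series_sqnorm a (snd (T x)) \<le> ennreal (2 * \<sigma> * (K * (H_norm a x)\<^sup>2))" if "x \<in> H_space a" for x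
    using series_sqnorm_le[OF a e(1)[OF that] e(2)[OF that] e(3)[OF that] \<sigma>]
      series_sqnorm_le[OF a e(1)[OF that] e(2)[OF that] e(4)[OF that] \<sigma>] by auto
  have in_H: "T x \<in> H_space a" if "x \<in> H_space a" for x
    using nrm[OF that] by (auto simp: H_space_def H1_space_def mem_Times_iff intro: le_less_trans)
  have bdd: "H_norm a (T x) \<le> sqrt (4 * \<sigma> * K) * H_norm a x" if "x \<in> H_space a" for x
  proof -
    have nn: "0 \<le> 2 * \<sigma> * (K * (H_norm a x)\<^sup>2)" using \<sigma>(1) K by simp
    have "(H_norm a (T x))\<^sup>2 \<le> 2 * \<sigma> * (K * (H_norm a x)\<^sup>2) + 2 * \<sigma> * (K * (H_norm a x)\<^sup>2)"
      unfolding H_norm_sq[of a "T x"] using nrm[OF that] nn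
      by (intro add_mono enn2real_leI) auto
    also have "\<dots> = (sqrt (4 * \<sigma> * K) * H_norm a x)\<^sup>2"
      using \<sigma>(1) K by (simp add: power_mult_distrib)
    finally show ?thesis
      by (rule power2_le_imp_le) (simp add: \<sigma>(1) K H_norm_nonneg)
  qed
  have seq: "\<exists>r y. strict_mono r \<and> y \<in> H_space a \<and> (\<lambda>i. H_norm a (T (x (r i)) - y)) \<longlonglongrightarrow> 0"
    if x: "\<And>i. x i \<in> H_space a" and B: "\<And>i. H_norm a (x i) \<le> B" for x :: "nat \<Rightarrow> series_pair" and B
  proof -
    have part: "(\<Sum>j<n. e (x i) j) \<le> K * B\<^sup>2" for i n
      by (rule order_trans[OF e(2)[OF x]]) (intro mult_left_mono power_mono B H_norm_nonneg K)
    obtain r1 g1 where 1: "strict_mono (r1 :: nat \<Rightarrow> nat)" "g1 \<in> H1_space a"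
      "(\<lambda>i. series_sqnorm a (fst (T (x (r1 i))) - g1)) \<longlonglongrightarrow> 0"
      using levelwise_bounded_relatively_compact[OF a, of "\<lambda>i. e (x i)" "K * B\<^sup>2" "\<lambda>i. fst (T (x i))"]
        e(1)[OF x] e(3)[OF x] part by auto
    obtain r2 g2 where 2: "strict_mono (r2 :: nat \<Rightarrow> nat)" "g2 \<in> H1_space a"
      "(\<lambda>i. series_sqnorm a (snd (T (x (r1 (r2 i)))) - g2)) \<longlonglongrightarrow> 0"
      using levelwise_bounded_relatively_compact[OF a, of "\<lambda>i. e (x (r1 i))" "K * B\<^sup>2" "\<lambda>i. snd (T (x (r1 i)))"]
        e(1)[OF x] e(4)[OF x] part by auto
    have 3: "(\<lambda>i. series_sqnorm a (fst (T (x (r1 (r2 i)))) - g1)) \<longlonglongrightarrow> 0"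
      using LIMSEQ_subseq_LIMSEQ[OF 1(3) 2(1)] by (simp add: o_def)
    have "(\<lambda>i. sqrt (enn2real (series_sqnorm a (fst (T (x (r1 (r2 i)))) - g1)) +
        enn2real (series_sqnorm a (snd (T (x (r1 (r2 i)))) - g2)))) \<longlonglongrightarrow> sqrt (enn2real 0 + enn2real 0)"
      by (intro tendsto_intros) (use 2(3) 3 in auto)
    then have "(\<lambda>i. H_norm a (T (x ((r1 \<circ> r2) i)) - (g1, g2))) \<longlonglongrightarrow> 0"
      by (simp add: H_norm_def)
    moreover have "strict_mono (r1 \<circ> r2)" by (rule strict_mono_o[OF 1(1) 2(1)])
    moreover have "(g1, g2) \<in> H_space a" using 1(2) 2(2) by (simp add: H_space_def)
    ultimately show ?thesis by blast
  qed
  have "bounded_operator a T"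
    unfolding bounded_operator_def using in_H add scale bdd by blast
  then show ?thesis
    unfolding compact_operator_def using seq by blast
qed

section \<open>Energies of coefficient sequences and levels\<close>

text \<open>
  The squared norm of the single coefficient sequence with index \<open>m\<close>, as a real number; it is
  meaningful only if that norm is finite.
\<close>

definition energy :: "(nat \<Rightarrow> nat \<Rightarrow> real) \<Rightarrow> series \<Rightarrow> int \<Rightarrow> real" where
  "energy a f m = (\<Sum>k. 1 / a (nat \<bar>m\<bar>) k * (cmod (f m k))\<^sup>2)"

text \<open>
  The part of the squared norm of a pair that lives at level \<open>n\<close>. At \<open>n = 0\<close> the only index
  is counted twice, which is harmless for upper bounds.
\<close>

definition level_energy :: "(nat \<Rightarrow> nat \<Rightarrow> real) \<Rightarrow> series_pair \<Rightarrow> nat \<Rightarrow> real" where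
  "level_energy a x n = energy a (fst x) (int n) + energy a (fst x) (- int n)
     + energy a (snd x) (int n) + energy a (snd x) (- int n)"

lemma sum_block_le_sqnorm:
  assumes "finite F"
  shows "(\<Sum>m\<in>F. \<Sum>k. ennreal (1 / a (nat \<bar>m\<bar>) k * (cmod (f m k))\<^sup>2)) \<le> series_sqnorm a f"
proof -
  let ?h = "\<lambda>m. \<Sum>k. ennreal (1 / a (nat \<bar>m\<bar>) k * (cmod (f m k))\<^sup>2)"
  have "(\<Sum>m\<in>F. ?h m) = (\<integral>\<^sup>+m. ?h m \<partial>count_space F)"
    using assms by (simp add: nn_integral_count_space_finite)
  also have "\<dots> \<le> (\<integral>\<^sup>+m. ?h m \<partial>count_space UNIV)"
    using assms
    by (subst nn_integral_count_space_indicator)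
      (auto intro!: nn_integral_mono simp: indicator_def)
  also have "\<dots> = series_sqnorm a f"
    unfolding series_sqnorm_eq_nn_integral
    by (subst nn_integral_fst_count_space[symmetric]) (simp add: nn_integral_count_space_nat)
  finally show ?thesis .
qed

lemma H1_zero: "(\<lambda>m k. 0) \<in> H1_space a"
  by (simp add: H1_space_def series_sqnorm_eq_nn_integral)

context
  fixes a :: "nat \<Rightarrow> nat \<Rightarrow> real" and f :: series
  assumes a: "coeff_cond_a a" and f: "f \<in> H1_space a"
begin

lemma weighted_sq_nonneg: "0 \<le> 1 / a n k * (cmod z)\<^sup>2"
  using a by (simp add: coeff_cond_a_def less_imp_le)

lemma energy_summable: "summable (\<lambda>k. 1 / a (nat \<bar>m\<bar>) k * (cmod (f m k))\<^sup>2)"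
proof (rule summable_suminf_not_top)
  show "(\<Sum>k. ennreal (1 / a (nat \<bar>m\<bar>) k * (cmod (f m k))\<^sup>2)) \<noteq> top"
    using sum_block_le_sqnorm[of "{m}" a f] f by (auto simp: H1_space_def top_unique)
qed (rule weighted_sq_nonneg)

lemma energy_nonneg: "0 \<le> energy a f m"
  unfolding energy_def by (rule suminf_nonneg[OF energy_summable weighted_sq_nonneg])

lemma weighted_sq_le_energy: "1 / a (nat \<bar>m\<bar>) k * (cmod (f m k))\<^sup>2 \<le> energy a f m"
  unfolding energy_def
  using sum_le_suminf[OF energy_summable, of "{k}"] weighted_sq_nonneg by simp

lemma sum_energy_le:
  assumes "finite F"
  shows "(\<Sum>m\<in>F. energy a f m) \<le> enn2real (series_sqnorm a f)"
proof -
  have "ennreal (\<Sum>m\<in>F. energy a f m) = (\<Sum>m\<in>F. ennreal (energy a f m))"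
    using energy_nonneg by (intro sum_ennreal[symmetric])
  also have "\<dots> = (\<Sum>m\<in>F. \<Sum>k. ennreal (1 / a (nat \<bar>m\<bar>) k * (cmod (f m k))\<^sup>2))"
    unfolding energy_def
    by (intro sum.cong refl suminf_ennreal2[symmetric] energy_summable weighted_sq_nonneg)
  also have "\<dots> \<le> series_sqnorm a f" by (rule sum_block_le_sqnorm[OF assms])
  finally have "enn2real (ennreal (\<Sum>m\<in>F. energy a f m)) \<le> enn2real (series_sqnorm a f)"
    using f by (intro enn2real_mono) (auto simp: H1_space_def)
  then show ?thesis by (simp add: sum_nonneg energy_nonneg)
qed

end

lemma level_energy_nonneg:
  assumes "coeff_cond_a a" "x \<in> H_space a"
  shows "0 \<le> level_energy a x n"
  using assms by (auto simp: level_energy_def H_space_def intro!: add_nonneg_nonneg energy_nonneg)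

lemma sum_level_energy_le:
  assumes a: "coeff_cond_a a" and x: "x \<in> H_space a"
  shows "(\<Sum>n<N. level_energy a x n) \<le> 2 * (H_norm a x)\<^sup>2"
proof -
  have part: "(\<Sum>n<N. energy a f (int n)) \<le> enn2real (series_sqnorm a f)"
    "(\<Sum>n<N. energy a f (- int n)) \<le> enn2real (series_sqnorm a f)" if f: "f \<in> H1_space a" for f
    using sum_energy_le[OF a f, of "int ` {..<N}"] sum_energy_le[OF a f, of "(\<lambda>n. - int n) ` {..<N}"]
    by (simp_all add: sum.reindex inj_on_def)
  show ?thesis
    using part[of "fst x"] part[of "snd x"] x
    by (auto simp: level_energy_def sum.distrib H_norm_sq H_space_def)
qed

text \<open>
  With truncated subtraction, level 0 contributes twice to the second summand, at $n = 0$ and at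
  $n = 1$.
\<close>

lemma sum_shifted_level_energy_le:
  assumes a: "coeff_cond_a a" and x: "x \<in> H_space a"
  shows "(\<Sum>n<N. level_energy a x (n + 1) + level_energy a x (n - 1)) \<le> 6 * (H_norm a x)\<^sup>2"
proof -
  note nn = level_energy_nonneg[OF a x]
  have 1: "(\<Sum>n<N. level_energy a x (n + 1)) \<le> 2 * (H_norm a x)\<^sup>2"
    using sum_level_energy_le[OF a x, of "Suc N"] nn[of 0] by (simp only: sum.lessThan_Suc_shift) simp
  have 2: "(\<Sum>n<N. level_energy a x (n - 1)) \<le> 4 * (H_norm a x)\<^sup>2"
  proof (cases N)
    case (Suc M)
    have "level_energy a x 0 \<le> 2 * (H_norm a x)\<^sup>2" using sum_level_energy_le[OF a x, of 1] by simp
    then show ?thesis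
      using sum_level_energy_le[OF a x, of M] by (simp add: Suc sum.lessThan_Suc_shift del: sum.lessThan_Suc)
  qed simp
  show ?thesis using 1 2 by (simp add: sum.distrib)
qed

lemma weighted_Cauchy_Schwarz:
  fixes u :: "nat \<Rightarrow> complex" and \<alpha> \<beta> :: "nat \<Rightarrow> real"
  assumes pos: "\<And>k. 0 < \<alpha> k" "\<And>k. 0 < \<beta> k"
    and u: "summable (\<lambda>k. 1 / \<alpha> k * (cmod (u k))\<^sup>2)"
    and t: "summable (\<lambda>k. \<alpha> k / (\<beta> k)\<^sup>2)"
  shows "summable (\<lambda>k. cmod (u k) / \<beta> k)"
    and "(\<Sum>k. cmod (u k) / \<beta> k) \<le>
      sqrt ((\<Sum>k. \<alpha> k / (\<beta> k)\<^sup>2) * (\<Sum>k. 1 / \<alpha> k * (cmod (u k))\<^sup>2))"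
proof -
  let ?B = "sqrt ((\<Sum>k. \<alpha> k / (\<beta> k)\<^sup>2) * (\<Sum>k. 1 / \<alpha> k * (cmod (u k))\<^sup>2))"
  have nn: "0 \<le> cmod (u k) / \<beta> k" "0 \<le> \<alpha> k / (\<beta> k)\<^sup>2" "0 \<le> 1 / \<alpha> k * (cmod (u k))\<^sup>2" for k
    using pos[of k] by simp_all
  have part: "(\<Sum>k<n. cmod (u k) / \<beta> k) \<le> ?B" for n
  proof (rule real_le_rsqrt)
    have eq: "sqrt (\<alpha> k) / \<beta> k * (cmod (u k) / sqrt (\<alpha> k)) = cmod (u k) / \<beta> k" for k
      using pos[of k] by simp
    have "(\<Sum>k<n. cmod (u k) / \<beta> k)\<^sup>2 = (\<Sum>k<n. (sqrt (\<alpha> k) / \<beta> k) * (cmod (u k) / sqrt (\<alpha> k)))\<^sup>2"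
      by (simp only: eq)
    also have "\<dots> \<le> (\<Sum>k<n. (sqrt (\<alpha> k) / \<beta> k)\<^sup>2) * (\<Sum>k<n. (cmod (u k) / sqrt (\<alpha> k))\<^sup>2)"
      by (rule Cauchy_Schwarz_ineq_sum)
    also have "\<dots> = (\<Sum>k<n. \<alpha> k / (\<beta> k)\<^sup>2) * (\<Sum>k<n. 1 / \<alpha> k * (cmod (u k))\<^sup>2)"
      using pos by (simp add: power_divide less_imp_le)
    also have "\<dots> \<le> (\<Sum>k. \<alpha> k / (\<beta> k)\<^sup>2) * (\<Sum>k. 1 / \<alpha> k * (cmod (u k))\<^sup>2)"
      by (intro mult_mono sum_le_suminf t u sum_nonneg suminf_nonneg nn) auto
    finally show "(\<Sum>k<n. cmod (u k) / \<beta> k)\<^sup>2 \<le> \<dots>" .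
  qed
  show "summable (\<lambda>k. cmod (u k) / \<beta> k)"
    by (rule summableI_nonneg_bounded[OF nn(1) part])
  then show "(\<Sum>k. cmod (u k) / \<beta> k) \<le> ?B"
    by (rule suminf_le_const[OF _ part])
qed

section \<open>Integrating factors and the first order equations\<close>

text \<open>
  The coefficient conditions with explicit constants: \<open>\<kappa>\<close> bounds the partial products of $c_\pm$
  from below and by $1/\kappa$ from above, and \<open>\<tau>\<close> bounds
  $t(n) = \sum_k a^{(n)}(k) / b^{(n)}(k)^2$.
\<close>

locale dirac_coefficients =
  fixes a b cp cm :: "nat \<Rightarrow> nat \<Rightarrow> real" and \<kappa> \<tau> :: real
  assumes a: "coeff_cond_a a"
    and b_pos: "\<And>n k. 0 < b n k"
    and t_summable: "\<And>n. summable (\<lambda>k. a n k / (b n k)\<^sup>2)"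
    and t_le: "\<And>n. (\<Sum>k. a n k / (b n k)\<^sup>2) \<le> \<tau>"
    and \<kappa>: "0 < \<kappa>" "\<kappa> \<le> 1"
    and cp_bounds: "\<And>n k. \<kappa> \<le> (\<Prod>j<k. cp n j)" "\<And>n k. (\<Prod>j<k. cp n j) \<le> 1 / \<kappa>"
    and cm_bounds: "\<And>n k. \<kappa> \<le> (\<Prod>j<k. cm n j)" "\<And>n k. (\<Prod>j<k. cm n j) \<le> 1 / \<kappa>"
    and cp_conv: "\<And>n. convergent_prod (\<lambda>k. 1 / cp n k)"
    and cm_conv: "\<And>n. convergent_prod (\<lambda>k. 1 / cm n k)"
begin

text \<open>
  The integrating factor. For every integer index \<open>m\<close> it turns the Jacobi type operator into a
  plain difference of the sequence \<open>gauge m k * f m k\<close>. For $m \ge 0$ it is the partial product of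
  $c_+^{(m)}$, for $m < 0$ the reciprocal of the partial product of $c_-^{(-m-1)}$.
\<close>

definition gauge :: "int \<Rightarrow> nat \<Rightarrow> real" where
  "gauge m k = (if m < 0 then 1 / (\<Prod>j<k. cm (nat (- m) - 1) j) else (\<Prod>j<k. cp (nat m) j))"

text \<open>This limit exists and lies between \<open>\<kappa>\<close> and \<open>1 / \<kappa>\<close>.\<close>

definition gauge_inf :: "int \<Rightarrow> real" where
  "gauge_inf m = lim (gauge m)"

lemma gauge_bounds: "\<kappa> \<le> gauge m k" "gauge m k \<le> 1 / \<kappa>"
proof -
  have "\<kappa> \<le> 1 / P \<and> 1 / P \<le> 1 / \<kappa>" if "\<kappa> \<le> P" "P \<le> 1 / \<kappa>" for P
    using that \<kappa> by (auto simp: field_simps)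
  then show "\<kappa> \<le> gauge m k" "gauge m k \<le> 1 / \<kappa>"
    using cp_bounds cm_bounds by (auto simp: gauge_def)
qed

lemma gauge_pos: "0 < gauge m k"
  using gauge_bounds(1)[of m k] \<kappa> by linarith

lemma gauge_0 [simp]: "gauge m 0 = 1"
  by (simp add: gauge_def)

lemma gauge_Suc_nonneg: "0 \<le> m \<Longrightarrow> gauge m (Suc k) = gauge m k * cp (nat m) k"
  by (simp add: gauge_def)

lemma gauge_Suc_neg: "m < 0 \<Longrightarrow> gauge m k = gauge m (Suc k) * cm (nat (- m) - 1) k"
  using cm_bounds(1)[of "nat (- m) - 1" "Suc k"] \<kappa> by (auto simp: gauge_def)

lemma gauge_tendsto: "gauge m \<longlonglongrightarrow> gauge_inf m"
proof -
  have conv: "convergent (\<lambda>k. 1 / (\<Prod>j<k. c j))" if "convergent_prod (\<lambda>k. 1 / c k)" for c :: "nat \<Rightarrow> real"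
  proof -
    have "convergent (\<lambda>k. \<Prod>j\<le>k. 1 / c j)"
      by (rule convergent_prod_imp_convergent[OF that])
    then have "convergent (\<lambda>k. (\<lambda>k. \<Prod>j<k. 1 / c j) (Suc k))"
      by (simp only: lessThan_Suc_atMost)
    then show ?thesis
      by (subst (asm) convergent_Suc_iff) (simp add: prod_dividef)
  qed
  have "convergent (gauge m)"
  proof (cases "m < 0")
    case True
    then show ?thesis using conv[OF cm_conv] by (simp add: gauge_def[abs_def])
  next
    case False
    obtain l where l: "(\<lambda>k. 1 / (\<Prod>j<k. cp (nat m) j)) \<longlonglongrightarrow> l"
      using conv[OF cp_conv] by (auto simp: convergent_def)
    have "\<kappa> \<le> l"
    proof (rule LIMSEQ_le_const[OF l], intro exI allI impI)
      fix k
      show "\<kappa> \<le> 1 / (\<Prod>j<k. cp (nat m) j)"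
        using cp_bounds[where n="nat m" and k=k] \<kappa> by (auto simp: field_simps)
    qed
    then have "(\<lambda>k. 1 / (1 / (\<Prod>j<k. cp (nat m) j))) \<longlonglongrightarrow> 1 / l"
      using \<kappa> by (intro tendsto_intros l) auto
    then show ?thesis using False by (auto simp: gauge_def[abs_def] convergent_def)
  qed
  then show ?thesis by (simp add: gauge_inf_def convergent_LIMSEQ_iff)
qed

lemma gauge_inf_bounds: "\<kappa> \<le> gauge_inf m" "gauge_inf m \<le> 1 / \<kappa>"
  using LIMSEQ_le_const[OF gauge_tendsto] LIMSEQ_le_const2[OF gauge_tendsto] gauge_bounds by blast+

lemma gauge_inf_pos: "0 < gauge_inf m"
  using gauge_inf_bounds(1)[of m] \<kappa> by linarith

text \<open>
  Since the coefficient of $\delta f$ with index $m + 1$ depends on that of $f$ with index $m$ only,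
  the equation $\delta f = p$ splits into one first order equation
  $(\delta f)_{m+1} = u$ for each \<open>m\<close>. Its right hand side in the gauge is \<open>source m u\<close>.
\<close>

definition source :: "int \<Rightarrow> (nat \<Rightarrow> complex) \<Rightarrow> nat \<Rightarrow> complex" where
  "source m u k = complex_of_real (gauge m k / b (nat \<bar>m + 1\<bar>) k) * u k"

text \<open>
  The partial sums of the source. For $m < 0$ the operator is a backward difference, so the sum
  includes the index \<open>k\<close>; for $m \ge 0$ it is a forward difference, and the sum stops before \<open>k\<close>.
\<close>

definition primitive :: "int \<Rightarrow> (nat \<Rightarrow> complex) \<Rightarrow> nat \<Rightarrow> complex" where
  "primitive m u k = (\<Sum>j<(if m < 0 then Suc k else k). source m u j)"

text \<open>The limit of the primitive at infinity.\<close>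

definition total :: "int \<Rightarrow> (nat \<Rightarrow> complex) \<Rightarrow> complex" where
  "total m u = (\<Sum>j. source m u j)"

text \<open>
  The solution of $(\delta f)_{m+1} = u$ with free constant \<open>\<zeta>\<close>. For $m \ge 0$ the constant is
  the value at $k = 0$; for $m < 0$ there is no freedom and \<open>\<zeta>\<close> must vanish.
\<close>

definition block_solution :: "complex \<Rightarrow> int \<Rightarrow> (nat \<Rightarrow> complex) \<Rightarrow> nat \<Rightarrow> complex" where
  "block_solution \<zeta> m u k = (\<zeta> + primitive m u k) / complex_of_real (gauge m k)"

lemma source_delta:
  "source m (delta b cp cm f (m + 1)) k =
    (if m < 0 then complex_of_real (gauge m k) * f m k
        - (if k = 0 then 0 else complex_of_real (gauge m (k - 1)) * f m (k - 1))
     else complex_of_real (gauge m (Suc k)) * f m (Suc k) - complex_of_real (gauge m k) * f m k)"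
proof (cases "m < 0")
  case True
  define l where "l = nat (- m) - 1"
  have n: "m + 1 = - int l" "- int (l + 1) = m"
    using True by (auto simp: l_def)
  have "minus_part f (l + 1) = f m" by (simp only: minus_part_def n(2))
  then have d: "delta b cp cm f (m + 1) k =
      complex_of_real (b l k) * (f m k - (if k = 0 then 0 else complex_of_real (cm l (k - 1)) * f m (k - 1)))"
    unfolding n(1) by (simp add: delta_def jacobi_A_def)
  have "b l k \<noteq> 0" "nat \<bar>m + 1\<bar> = l" using b_pos[of l k] n(1) by simp_all
  then show ?thesis
    unfolding source_def d
    using True gauge_Suc_neg[OF True, of "k - 1", folded l_def] by (cases k) (simp_all add: algebra_simps)
next
  case False
  define l where "l = nat m"
  have n: "m = int l" using False by (simp add: l_def)
  have d: "delta b cp cm f (m + 1) k =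
      - complex_of_real (b (l + 1) k) * (f m k - complex_of_real (cp l k) * f m (k + 1))"
    unfolding n by (simp add: delta_def jacobi_Abar_def plus_part_def)
  have "b (l + 1) k \<noteq> 0" "nat \<bar>m + 1\<bar> = l + 1" using b_pos[of "l + 1" k] n by simp_all
  then show ?thesis
    unfolding source_def d
    using False gauge_Suc_nonneg[of m k] by (simp add: algebra_simps flip: l_def)
qed

text \<open>Uniqueness of the solution, by summing \<open>source_delta\<close>.\<close>

lemma eq_block_solution_delta: "f m k = block_solution (if m < 0 then 0 else f m 0) m (delta b cp cm f (m + 1)) k"
proof -
  let ?g = "\<lambda>k. complex_of_real (gauge m k) * f m k"
  have "(if m < 0 then 0 else f m 0) + primitive m (delta b cp cm f (m + 1)) k = ?g k"
  proof (cases "m < 0")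
    case True
    have "(\<Sum>j<Suc k. ?g j - (if j = 0 then 0 else ?g (j - 1))) = ?g k"
      by (induction k) auto
    then show ?thesis using True by (simp only: primitive_def source_delta if_True) simp
  next
    case False
    then show ?thesis
      by (simp add: primitive_def source_delta sum_lessThan_telescope[of ?g])
  qed
  then show ?thesis using gauge_pos[of m k] by (simp add: block_solution_def)
qed

text \<open>Existence of the solution.\<close>

lemma delta_eqI_block_solution:
  assumes f: "\<And>k. f m k = block_solution \<zeta> m u k" and \<zeta>: "m < 0 \<Longrightarrow> \<zeta> = 0"
  shows "delta b cp cm f (m + 1) = u"
proof
  fix k
  have g: "complex_of_real (gauge m k) * f m k = \<zeta> + primitive m u k" for k
    using gauge_pos[of m k] by (simp add: f block_solution_def)
  have "source m (delta b cp cm f (m + 1)) k = source m u k"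
    unfolding source_delta g using \<zeta> by (cases k) (auto simp: primitive_def)
  then show "delta b cp cm f (m + 1) k = u k"
    using gauge_pos[of m k] b_pos[of "nat \<bar>m + 1\<bar>" k] by (simp add: source_def)
qed

text \<open>
  This is where the weights $a$ and the coefficients $b$ interact: the Cauchy-Schwarz inequality
  makes $u/b$ absolutely summable for $u \in \ell^2_a$, uniformly in the index.
\<close>

lemma source_summable_bound:
  assumes "p \<in> H1_space a"
  shows "summable (\<lambda>k. cmod (source m (p (m + 1)) k))"
    and "(\<Sum>k. cmod (source m (p (m + 1)) k)) \<le> sqrt (\<tau> * energy a p (m + 1)) / \<kappa>"
proof -
  let ?n = "nat \<bar>m + 1\<bar>" and ?u = "p (m + 1)"
  have a_pos: "0 < a ?n k" for k using a by (simp add: coeff_cond_a_def)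
  note CS = weighted_Cauchy_Schwarz[of "a ?n" "b ?n" ?u, OF a_pos b_pos energy_summable[OF a assms] t_summable]
  have le: "cmod (source m ?u k) \<le> 1 / \<kappa> * (cmod (?u k) / b ?n k)" for k
  proof -
    have "cmod (source m ?u k) = gauge m k * (cmod (?u k) / b ?n k)"
      using gauge_pos[of m k] b_pos[of ?n k] by (simp add: source_def norm_mult norm_divide)
    also have "\<dots> \<le> 1 / \<kappa> * (cmod (?u k) / b ?n k)"
      using b_pos[of ?n k] by (intro mult_right_mono gauge_bounds) simp
    finally show ?thesis .
  qed
  show s: "summable (\<lambda>k. cmod (source m ?u k))"
    by (rule summable_comparison_test[OF _ summable_mult[OF CS(1), of "1 / \<kappa>"]])
      (intro exI allI impI, simp only: real_norm_def abs_norm_cancel le)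
  have "(\<Sum>k. cmod (source m ?u k)) \<le> (\<Sum>k. 1 / \<kappa> * (cmod (?u k) / b ?n k))"
    by (rule suminf_le[OF le s summable_mult[OF CS(1)]])
  also have "\<dots> = 1 / \<kappa> * (\<Sum>k. cmod (?u k) / b ?n k)"
    by (rule suminf_mult[OF CS(1)])
  also have "\<dots> \<le> 1 / \<kappa> * sqrt ((\<Sum>k. a ?n k / (b ?n k)\<^sup>2) * energy a p (m + 1))"
    unfolding energy_def using \<kappa> by (intro mult_left_mono CS(2)) simp
  also have "\<dots> \<le> 1 / \<kappa> * sqrt (\<tau> * energy a p (m + 1))"
    using \<kappa> by (intro mult_left_mono real_sqrt_le_mono mult_right_mono t_le energy_nonneg[OF a assms]) simp
  finally show "(\<Sum>k. cmod (source m ?u k)) \<le> sqrt (\<tau> * energy a p (m + 1)) / \<kappa>"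
    by simp
qed

lemma source_summable: "p \<in> H1_space a \<Longrightarrow> summable (source m (p (m + 1)))"
  using source_summable_bound(1) by (rule summable_norm_cancel)

lemma primitive_tendsto:
  assumes "p \<in> H1_space a"
  shows "primitive m (p (m + 1)) \<longlonglongrightarrow> total m (p (m + 1))"
proof -
  have "(\<lambda>k. \<Sum>j<k. source m (p (m + 1)) j) \<longlonglongrightarrow> total m (p (m + 1))"
    using source_summable[OF assms] by (simp add: total_def summable_LIMSEQ)
  then show ?thesis
    using LIMSEQ_Suc by (cases "m < 0") (simp_all add: primitive_def[abs_def] del: sum.lessThan_Suc)
qed

lemma block_solution_tendsto:
  assumes "p \<in> H1_space a"
  shows "block_solution \<zeta> m (p (m + 1)) \<longlonglongrightarrow> (\<zeta> + total m (p (m + 1))) / complex_of_real (gauge_inf m)"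
  unfolding block_solution_def[abs_def] using gauge_inf_pos[of m]
  by (intro tendsto_intros primitive_tendsto[OF assms] gauge_tendsto) auto

lemma total_primitive_bound:
  assumes "p \<in> H1_space a"
  shows "cmod (total m (p (m + 1))) \<le> sqrt (\<tau> * energy a p (m + 1)) / \<kappa>"
    and "cmod (primitive m (p (m + 1)) k) \<le> sqrt (\<tau> * energy a p (m + 1)) / \<kappa>"
proof -
  note s = source_summable_bound[OF assms, of m]
  show "cmod (total m (p (m + 1))) \<le> sqrt (\<tau> * energy a p (m + 1)) / \<kappa>"
    unfolding total_def by (rule order_trans[OF summable_norm[OF s(1)] s(2)])
  have "cmod (primitive m (p (m + 1)) k) \<le> (\<Sum>j<(if m < 0 then Suc k else k). cmod (source m (p (m + 1)) j))"
    unfolding primitive_def by (rule norm_sum)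
  also have "\<dots> \<le> (\<Sum>j. cmod (source m (p (m + 1)) j))"
    by (rule sum_le_suminf[OF s(1)]) auto
  finally show "cmod (primitive m (p (m + 1)) k) \<le> sqrt (\<tau> * energy a p (m + 1)) / \<kappa>"
    using s(2) by linarith
qed

section \<open>Solutions satisfying the boundary conditions\<close>

lemma source_linear:
  "source m (\<lambda>k. u k + v k) k = source m u k + source m v k"
  "source m (\<lambda>k. c * u k) k = c * source m u k"
  by (simp_all add: source_def algebra_simps add_divide_distrib)

lemma primitive_linear:
  "primitive m (\<lambda>k. u k + v k) k = primitive m u k + primitive m v k"
  "primitive m (\<lambda>k. c * u k) k = c * primitive m u k"
  by (simp_all add: primitive_def source_linear sum.distrib sum_distrib_left)

lemma total_linear:
  assumes "p \<in> H1_space a" "q \<in> H1_space a"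
  shows "total m (\<lambda>k. p (m + 1) k + q (m + 1) k) = total m (p (m + 1)) + total m (q (m + 1))"
    and "total m (\<lambda>k. c * p (m + 1) k) = c * total m (p (m + 1))"
  using suminf_add[OF source_summable[OF assms(1)] source_summable[OF assms(2)], of m m]
    suminf_mult[OF source_summable[OF assms(1)], of c]
  by (simp_all add: total_def source_linear)

lemma total_reflect_linear:
  assumes "p \<in> H1_space a" "q \<in> H1_space a"
  shows "total (- m) (\<lambda>k. p (1 - m) k + q (1 - m) k) = total (- m) (p (1 - m)) + total (- m) (q (1 - m))"
    and "total (- m) (\<lambda>k. c * p (1 - m) k) = c * total (- m) (p (1 - m))"
  using total_linear[OF assms, of "- m"] by simp_all

text \<open>
  The free constants that enforce the boundary conditions. For $m > 0$ the limit of the first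
  series at index \<open>m\<close> must be the limit of the second series at index \<open>- m\<close>, which is already
  determined by \<open>q\<close>. At $m = 0$ the constant \<open>z\<close> is left open.
\<close>

definition initial_value :: "complex \<Rightarrow> series \<Rightarrow> series \<Rightarrow> int \<Rightarrow> complex" where
  "initial_value z p q m =
    (if m < 0 then 0 else if m = 0 then z
     else complex_of_real (gauge_inf m / gauge_inf (- m)) * total (- m) (q (- m + 1)) - total m (p (m + 1)))"

text \<open>The first component of the solution of $D(f, g) = (p, q)$ with $f_0^+(0) = z$.\<close>

definition series_solution :: "complex \<Rightarrow> series \<Rightarrow> series \<Rightarrow> series" where
  "series_solution z p q m k = block_solution (initial_value z p q m) m (p (m + 1)) k"

text \<open>
  The solution $(f, g)$ of $D(f, g) = y$ with $f_0^+(0) = z$. The condition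
  $f_0^+(\infty) = g_0^+(\infty)$ determines $g_0^+(0)$, which is the constant passed to the second
  component.
\<close>

definition solution :: "complex \<Rightarrow> series_pair \<Rightarrow> series_pair" where
  "solution z y =
    (series_solution z (fst y) (snd y),
     series_solution (z + total 0 (fst y (0 + 1)) - total 0 (snd y (0 + 1))) (snd y) (fst y))"

lemma series_solution_add:
  assumes "p \<in> H1_space a" "q \<in> H1_space a" "p' \<in> H1_space a" "q' \<in> H1_space a"
  shows "series_solution (z + z') (p + p') (q + q') = series_solution z p q + series_solution z' p' q'"
  using assms
  by (intro ext) (simp add: series_solution_def initial_value_def block_solution_def plus_fun_def primitive_linear total_linear total_reflect_linear
      algebra_simps add_divide_distrib diff_divide_distrib)

lemma series_solution_scale:
  assumes "p \<in> H1_space a" "q \<in> H1_space a"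
  shows "series_solution (c * z) (\<lambda>m k. c * p m k) (\<lambda>m k. c * q m k) = (\<lambda>m k. c * series_solution z p q m k)"
  using assms
  by (intro ext) (simp add: series_solution_def initial_value_def block_solution_def primitive_linear total_linear total_reflect_linear algebra_simps)

lemma solution_add:
  assumes "x \<in> H_space a" "y \<in> H_space a"
  shows "solution (z + w) (x + y) = solution z x + solution w y"
proof -
  have mem: "fst x \<in> H1_space a" "snd x \<in> H1_space a" "fst y \<in> H1_space a" "snd y \<in> H1_space a"
    using assms by (auto simp: H_space_def)
  have t: "total 0 ((p + q) (0 + 1)) = total 0 (p (0 + 1)) + total 0 (q (0 + 1))"
    if "p \<in> H1_space a" "q \<in> H1_space a" for p q
    using total_linear(1)[OF that, of 0] by (simp add: plus_fun_def)
  have "z + w + total 0 ((fst x + fst y) (0 + 1)) - total 0 ((snd x + snd y) (0 + 1)) =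
     (z + total 0 (fst x (0 + 1)) - total 0 (snd x (0 + 1))) +
     (w + total 0 (fst y (0 + 1)) - total 0 (snd y (0 + 1)))"
    by (simp only: t mem) simp
  then show ?thesis
    by (simp only: solution_def fst_add snd_add series_solution_add mem) simp
qed

lemma solution_scale:
  assumes "x \<in> H_space a"
  shows "solution (c * z) (H_scale c x) = H_scale c (solution z x)"
proof -
  have mem: "fst x \<in> H1_space a" "snd x \<in> H1_space a"
    using assms by (auto simp: H_space_def)
  have "c * z + total 0 (\<lambda>k. c * fst x (0 + 1) k) - total 0 (\<lambda>k. c * snd x (0 + 1) k) =
      c * (z + total 0 (fst x (0 + 1)) - total 0 (snd x (0 + 1)))"
    by (simp only: total_linear(2)[OF mem(1) mem(1)] total_linear(2)[OF mem(2) mem(2)]) (simp add: algebra_simps)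
  then show ?thesis
    by (simp only: solution_def H_scale_def fst_conv snd_conv series_solution_scale mem)
qed

section \<open>Level estimates for solutions\<close>

lemma energy_le_level_energy:
  assumes y: "y \<in> H_space a" and p: "p = fst y \<or> p = snd y"
  shows "energy a p (m + 1) \<le> level_energy a y (nat \<bar>m\<bar> + 1) + level_energy a y (nat \<bar>m\<bar> - 1)"
proof -
  have mem: "fst y \<in> H1_space a" "snd y \<in> H1_space a"
    using y by (auto simp: H_space_def)
  note nn = energy_nonneg[OF a mem(1)] energy_nonneg[OF a mem(2)]
  have le: "energy a p (int n) \<le> level_energy a y n" "energy a p (- int n) \<le> level_energy a y n" for n
    using p nn[of "int n"] nn[of "- int n"] by (auto simp: level_energy_def)
  show ?thesis
  proof (cases "m < 0")
    case True
    then have "m + 1 = - int (nat \<bar>m\<bar> - 1)" by simp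
    then show ?thesis
      using le(2)[of "nat \<bar>m\<bar> - 1"] level_energy_nonneg[OF a y, of "nat \<bar>m\<bar> + 1"] by simp
  next
    case False
    then have "int (nat \<bar>m\<bar> + 1) = m + 1" by simp
    then show ?thesis
      using le(1)[of "nat \<bar>m\<bar> + 1"] level_energy_nonneg[OF a y, of "nat \<bar>m\<bar> - 1"] by (simp only:)
  qed
qed

lemma \<tau>_nonneg: "0 \<le> \<tau>"
proof -
  have "0 \<le> (\<Sum>k. a 0 k / (b 0 k)\<^sup>2)"
    using a by (intro suminf_nonneg t_summable) (simp add: coeff_cond_a_def less_imp_le)
  then show ?thesis using t_le[of 0] by linarith
qed

text \<open>
  The level estimate required by the compactness criterion. The coefficients of the solution at
  level \<open>n\<close> are controlled by those of \<open>y\<close> at the neighbouring levels and, for \<open>n = 0\<close>, by \<open>z\<close>.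
\<close>

lemma solution_levelwise:
  assumes y: "y \<in> H_space a"
  shows "\<exists>e. (\<forall>n. 0 \<le> e n) \<and>
    (\<forall>n. (\<Sum>j<n. e j) \<le> 2 / \<kappa>\<^sup>2 * (cmod z)\<^sup>2 + 300 * \<tau> / \<kappa> ^ 8 * (H_norm a y)\<^sup>2) \<and>
    (\<forall>m k. (cmod (fst (solution z y) m k))\<^sup>2 \<le> e (nat \<bar>m\<bar>) \<and>
           (cmod (snd (solution z y) m k))\<^sup>2 \<le> e (nat \<bar>m\<bar>))"
proof -
  define E where "E n = level_energy a y (n + 1) + level_energy a y (n - 1)" for n
  define \<omega> where "\<omega> n = sqrt (\<tau> * E n) / \<kappa>" for n
  define e where "e n = 2 / \<kappa>\<^sup>2 * (if n = 0 then (cmod z)\<^sup>2 else 0) + 50 * \<tau> / \<kappa> ^ 8 * E n" for n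
  have mem: "fst y \<in> H1_space a" "snd y \<in> H1_space a"
    using y by (auto simp: H_space_def)
  have E: "0 \<le> E n" for n
    using level_energy_nonneg[OF a y] by (simp add: E_def)
  have \<omega>: "0 \<le> \<omega> n" for n
    using E[of n] \<tau>_nonneg \<kappa> by (simp add: \<omega>_def)
  have bnd: "cmod (total m (p (m + 1))) \<le> \<omega> (nat \<bar>m\<bar>)" "cmod (primitive m (p (m + 1)) k) \<le> \<omega> (nat \<bar>m\<bar>)"
    if p: "p = fst y \<or> p = snd y" for p m k
  proof -
    have "sqrt (\<tau> * energy a p (m + 1)) / \<kappa> \<le> \<omega> (nat \<bar>m\<bar>)"
      unfolding \<omega>_def E_def
      using energy_le_level_energy[OF y p, of m] \<tau>_nonneg \<kappa>
      by (intro divide_right_mono real_sqrt_le_mono mult_left_mono) auto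
    then show "cmod (total m (p (m + 1))) \<le> \<omega> (nat \<bar>m\<bar>)" "cmod (primitive m (p (m + 1)) k) \<le> \<omega> (nat \<bar>m\<bar>)"
      using total_primitive_bound[of p m] p mem by (force intro: order_trans)+
  qed
  have k2: "1 \<le> 1 / \<kappa>\<^sup>2"
    using power_mono[of \<kappa> 1 2] \<kappa> by simp
  have \<omega>k: "\<omega> n \<le> \<omega> n / \<kappa>\<^sup>2" for n
    using mult_left_mono[OF k2 \<omega>[of n]] by simp
  have init_bound: "cmod (initial_value z' p q m) \<le> (if m = 0 then cmod z' else 0) + 2 * (\<omega> (nat \<bar>m\<bar>) / \<kappa>\<^sup>2)"
    if p: "p = fst y \<or> p = snd y" and q: "q = fst y \<or> q = snd y" for z' p q m
  proof (cases "m > 0")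
    case True
    have "gauge_inf m / gauge_inf (- m) \<le> (1 / \<kappa>) / \<kappa>"
      using gauge_inf_bounds gauge_inf_pos[of m] \<kappa> by (intro frac_le) auto
    then have r: "\<bar>gauge_inf m / gauge_inf (- m)\<bar> \<le> 1 / \<kappa>\<^sup>2"
      using gauge_inf_pos[of m] gauge_inf_pos[of "- m"] by (simp add: power2_eq_square)
    have "cmod (initial_value z' p q m) \<le> cmod (complex_of_real (gauge_inf m / gauge_inf (- m)) * total (- m) (q (- m + 1)))
        + cmod (total m (p (m + 1)))"
      using True by (simp add: initial_value_def norm_triangle_ineq4)
    also have "\<dots> \<le> 1 / \<kappa>\<^sup>2 * \<omega> (nat \<bar>m\<bar>) + \<omega> (nat \<bar>m\<bar>)"
      unfolding norm_mult norm_of_real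
      using bnd(1)[OF q, of "- m"] bnd(1)[OF p, of m] r by (intro add_mono mult_mono) auto
    finally show ?thesis using True \<omega>k[of "nat \<bar>m\<bar>"] by simp
  next
    case False
    then show ?thesis using \<omega>[of "nat \<bar>m\<bar>"] \<kappa> by (auto simp: initial_value_def)
  qed
  \<comment> \<open>The factor 5 is 2 from the initial value of the second component, 2 from the boundary
    condition and 1 from the primitive; \<open>e\<close> then results from $(x + y)^2 \le 2x^2 + 2y^2$.\<close>
  have series_solution_bound: "(cmod (series_solution z' p q m k))\<^sup>2 \<le> e (nat \<bar>m\<bar>)"
    if p: "p = fst y \<or> p = snd y" and q: "q = fst y \<or> q = snd y"
      and z': "cmod z' \<le> cmod z + 2 * \<omega> 0" for z' p q m k
  proof -
    let ?n = "nat \<bar>m\<bar>"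
    let ?z = "if m = 0 then cmod z else 0"
    have "cmod (series_solution z' p q m k) = cmod (initial_value z' p q m + primitive m (p (m + 1)) k) / gauge m k"
      using gauge_pos[of m k] by (simp add: series_solution_def block_solution_def norm_divide)
    also have "\<dots> \<le> (?z + 5 * (\<omega> ?n / \<kappa>\<^sup>2)) / \<kappa>"
    proof (rule frac_le)
      have "cmod (initial_value z' p q m) \<le> ?z + 4 * (\<omega> ?n / \<kappa>\<^sup>2)"
        using init_bound[OF p q, of z' m] z' \<omega>k[of ?n] \<omega>[of ?n] by (auto split: if_splits)
      moreover have "cmod (primitive m (p (m + 1)) k) \<le> \<omega> ?n / \<kappa>\<^sup>2"
        by (rule order_trans[OF bnd(2)[OF p] \<omega>k])
      ultimately show "cmod (initial_value z' p q m + primitive m (p (m + 1)) k) \<le> ?z + 5 * (\<omega> ?n / \<kappa>\<^sup>2)"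
        using norm_triangle_ineq[of "initial_value z' p q m" "primitive m (p (m + 1)) k"] by linarith
    qed (use \<kappa> gauge_bounds(1) \<omega>[of ?n] in auto)
    finally have "(cmod (series_solution z' p q m k))\<^sup>2 \<le> ((?z + 5 * (\<omega> ?n / \<kappa>\<^sup>2)) / \<kappa>)\<^sup>2"
      by (intro power_mono) auto
    also have "\<dots> \<le> (2 * ?z\<^sup>2 + 2 * (5 * (\<omega> ?n / \<kappa>\<^sup>2))\<^sup>2) / \<kappa>\<^sup>2"
      unfolding power_divide[of _ \<kappa>] 
      using zero_le_power2[of "?z - 5 * (\<omega> ?n / \<kappa>\<^sup>2)"]
      by (intro divide_right_mono) (simp_all add: power2_sum power2_diff)
    also have "(5 * (\<omega> ?n / \<kappa>\<^sup>2))\<^sup>2 = 25 * (\<tau> * E ?n / \<kappa> ^ 6)"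
      using E[of ?n] \<tau>_nonneg by (simp add: \<omega>_def power_mult_distrib power_divide flip: power_mult power_add)
    also have "(2 * ?z\<^sup>2 + 2 * (25 * (\<tau> * E ?n / \<kappa> ^ 6))) / \<kappa>\<^sup>2 = e ?n"
      using \<kappa> by (auto simp: e_def field_simps power2_eq_square eval_nat_numeral)
    finally show ?thesis .
  qed
  have "cmod (z + total 0 (fst y (0 + 1)) - total 0 (snd y (0 + 1))) \<le> cmod z + 2 * \<omega> 0"
    using bnd(1)[of "fst y" 0] bnd(1)[of "snd y" 0]
      norm_triangle_ineq4[of "z + total 0 (fst y (0 + 1))" "total 0 (snd y (0 + 1))"]
      norm_triangle_ineq[of z "total 0 (fst y (0 + 1))"] by simp
  then have bounds: "\<forall>m k. (cmod (fst (solution z y) m k))\<^sup>2 \<le> e (nat \<bar>m\<bar>) \<and>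
           (cmod (snd (solution z y) m k))\<^sup>2 \<le> e (nat \<bar>m\<bar>)"
    using \<omega>[of 0] by (auto simp only: solution_def fst_conv snd_conv intro!: series_solution_bound)
  have e_nonneg: "0 \<le> e n" for n
    using E[of n] \<tau>_nonneg \<kappa> by (simp add: e_def)
  have "(\<Sum>j<n. e j) \<le> 2 / \<kappa>\<^sup>2 * (cmod z)\<^sup>2 + 300 * \<tau> / \<kappa> ^ 8 * (H_norm a y)\<^sup>2" for n
  proof -
    have "(\<Sum>j<n. e j) = 2 / \<kappa>\<^sup>2 * (\<Sum>j<n. if j = 0 then (cmod z)\<^sup>2 else 0) + 50 * \<tau> / \<kappa> ^ 8 * (\<Sum>j<n. E j)"
      unfolding e_def sum.distrib sum_distrib_left ..
    also have "\<dots> \<le> 2 / \<kappa>\<^sup>2 * (cmod z)\<^sup>2 + 50 * \<tau> / \<kappa> ^ 8 * (6 * (H_norm a y)\<^sup>2)"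
      using \<tau>_nonneg \<kappa> sum_shifted_level_energy_le[OF a y, of n]
      by (intro add_mono mult_left_mono) (auto simp: E_def)
    finally show ?thesis by simp
  qed
  with bounds e_nonneg show ?thesis by blast
qed

lemma solution_in_H:
  assumes "y \<in> H_space a"
  shows "solution z y \<in> H_space a"
proof -
  obtain e where e: "\<And>n. 0 \<le> e n"
      "\<And>n. (\<Sum>j<n. e j) \<le> 2 / \<kappa>\<^sup>2 * (cmod z)\<^sup>2 + 300 * \<tau> / \<kappa> ^ 8 * (H_norm a y)\<^sup>2"
      "\<And>m k. (cmod (fst (solution z y) m k))\<^sup>2 \<le> e (nat \<bar>m\<bar>)"
      "\<And>m k. (cmod (snd (solution z y) m k))\<^sup>2 \<le> e (nat \<bar>m\<bar>)"
    using solution_levelwise[OF assms, of z] by blast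
  obtain \<sigma> where \<sigma>: "0 \<le> \<sigma>" "\<And>n. (\<Sum>k. 1 / a n k) \<le> \<sigma>"
    using coeff_cond_a_sum_bounded[OF a] by blast
  show ?thesis
    using series_sqnorm_le[OF a e(1,2), of "fst (solution z y)", OF e(3) \<sigma>]
      series_sqnorm_le[OF a e(1,2), of "snd (solution z y)", OF e(4) \<sigma>]
    by (auto simp: H_space_def H1_space_def mem_Times_iff intro: le_less_trans)
qed

section \<open>Inverting the Dirac type operator\<close>

lemma delta_series_solution: "delta b cp cm (series_solution z p q) = p"
proof
  fix n
  have "delta b cp cm (series_solution z p q) (n - 1 + 1) = p (n - 1 + 1)"
    by (rule delta_eqI_block_solution[of _ _ "initial_value z p q (n - 1)"]) (simp_all add: series_solution_def initial_value_def)
  then show "delta b cp cm (series_solution z p q) n = p n" by simp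
qed

lemma dirac_solution: "dirac b cp cm (solution z y) = y"
  by (simp add: dirac_def solution_def delta_series_solution)

lemma lim_series_solution:
  assumes "p \<in> H1_space a"
  shows "lim (series_solution z p q m) =
    (if m < 0 then total m (p (m + 1)) / complex_of_real (gauge_inf m)
     else if m = 0 then (z + total 0 (p (0 + 1))) / complex_of_real (gauge_inf 0)
     else total (- m) (q (- m + 1)) / complex_of_real (gauge_inf (- m)))"
proof -
  have "lim (series_solution z p q m) = (initial_value z p q m + total m (p (m + 1))) / complex_of_real (gauge_inf m)"
    unfolding series_solution_def[abs_def] by (rule limI[OF block_solution_tendsto[OF assms]])
  then show ?thesis
    using gauge_inf_pos[of m] gauge_inf_pos[of "- m"] by (auto simp: initial_value_def)
qed

lemma solution_in_dom:
  assumes "y \<in> H_space a"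
  shows "solution z y \<in> dirac_dom a b cp cm"
proof -
  have mem: "fst y \<in> H1_space a" "snd y \<in> H1_space a"
    using assms by (auto simp: H_space_def)
  have "series_sqnorm a (fst y) < \<infinity>" "series_sqnorm a (snd y) < \<infinity>"
    using mem by (auto simp: H1_space_def)
  then show ?thesis
    using solution_in_H[OF assms, of z] lim_series_solution[OF mem(1)] lim_series_solution[OF mem(2)]
    by (auto simp: dirac_dom_def solution_def delta_series_solution plus_part_def minus_part_def)
qed

text \<open>Every element of the domain is the solution with its own initial value.\<close>

lemma eq_solution_dirac:
  assumes x: "x \<in> dirac_dom a b cp cm"
  shows "dirac b cp cm x \<in> H_space a" and "x = solution (fst x 0 0) (dirac b cp cm x)"
proof -
  obtain f g where x_eq: "x = (f, g)" by (cases x)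
  define p where "p = delta b cp cm f"
  define q where "q = delta b cp cm g"
  have p: "p \<in> H1_space a" and q: "q \<in> H1_space a"
    using x by (auto simp: dirac_dom_def x_eq p_def q_def H1_space_def)
  then show "dirac b cp cm x \<in> H_space a"
    by (simp add: dirac_def x_eq H_space_def p_def q_def)
  have f: "f m = block_solution (if m < 0 then 0 else f m 0) m (p (m + 1))" for m
    unfolding p_def by (rule ext, rule eq_block_solution_delta)
  have g: "g m = block_solution (if m < 0 then 0 else g m 0) m (q (m + 1))" for m
    unfolding q_def by (rule ext, rule eq_block_solution_delta)
  have lim_f: "lim (f m) = ((if m < 0 then 0 else f m 0) + total m (p (m + 1))) / complex_of_real (gauge_inf m)" for m
    by (subst f) (rule limI[OF block_solution_tendsto[OF p]])
  have lim_g: "lim (g m) = ((if m < 0 then 0 else g m 0) + total m (q (m + 1))) / complex_of_real (gauge_inf m)" for m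
    by (subst g) (rule limI[OF block_solution_tendsto[OF q]])
  have bc0: "lim (f 0) = lim (g 0)"
    and bc: "\<And>n. n \<ge> 1 \<Longrightarrow> lim (f (int n)) = lim (g (- int n))" "\<And>n. n \<ge> 1 \<Longrightarrow> lim (f (- int n)) = lim (g (int n))"
    using x by (auto simp: dirac_dom_def x_eq plus_part_def minus_part_def)
  have g0: "g 0 0 = f 0 0 + total 0 (p (0 + 1)) - total 0 (q (0 + 1))"
    using bc0 gauge_inf_pos[of 0] by (simp add: lim_f lim_g algebra_simps)
  have f_init: "(if m < 0 then 0 else f m 0) = initial_value (f 0 0) p q m" for m
  proof (cases "m > 0")
    case True
    then have "lim (f m) = lim (g (- m))" using bc(1)[of "nat m"] by simp
    then show ?thesis
      using True gauge_inf_pos[of m] gauge_inf_pos[of "- m"] by (simp add: lim_f lim_g initial_value_def field_simps)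
  qed (auto simp: initial_value_def)
  have g_init: "(if m < 0 then 0 else g m 0) = initial_value (g 0 0) q p m" for m
  proof (cases "m > 0")
    case True
    then have "lim (f (- m)) = lim (g m)" using bc(2)[of "nat m"] by simp
    then show ?thesis
      using True gauge_inf_pos[of m] gauge_inf_pos[of "- m"] by (simp add: lim_f lim_g initial_value_def field_simps)
  qed (auto simp: initial_value_def)
  have "f = series_solution (f 0 0) p q"
    by (rule ext, subst f) (simp only: f_init series_solution_def[abs_def])
  moreover have "g = series_solution (g 0 0) q p"
    by (rule ext, subst g) (simp only: g_init series_solution_def[abs_def])
  ultimately show "x = solution (fst x 0 0) (dirac b cp cm x)"
    unfolding x_eq dirac_def solution_def fst_conv snd_conv p_def[symmetric] q_def[symmetric] g0[symmetric]
    by simp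
qed

lemma zero_in_H: "(0 :: series_pair) \<in> H_space a"
  using H1_zero[of a] by (simp add: H_space_def zero_prod_def zero_fun_def)

lemma H_norm_zero: "H_norm a (0 :: series_pair) = 0"
  by (simp add: H_norm_def series_sqnorm_eq_nn_integral)

lemma compact_solution_0: "compact_operator a (solution 0)"
proof (rule compact_operatorI_levelwise[OF a])
  show "solution 0 (x + y) = solution 0 x + solution 0 y" if "x \<in> H_space a" "y \<in> H_space a" for x y
    using solution_add[OF that, of 0 0] by simp
  show "solution 0 (H_scale z x) = H_scale z (solution 0 x)" if "x \<in> H_space a" for z x
    using solution_scale[OF that, of z 0] by simp
  show "0 \<le> 300 * \<tau> / \<kappa> ^ 8" using \<tau>_nonneg \<kappa> by simp
qed (use solution_levelwise[of _ 0] in simp)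

text \<open>
  This operator has rank one. The functional $(f, g) \mapsto f_0^+(0)$ is defined and bounded on the
  whole Hilbert space, in contrast to $(f, g) \mapsto f_0^+(\infty)$; this is the reason for normalizing solutions by
  their value at $k = 0$.
\<close>

lemma compact_kernel_part: "compact_operator a (\<lambda>x. solution (fst x 0 0) 0)"
proof (rule compact_operatorI_levelwise[OF a])
  show "solution (fst (x + y) 0 0) 0 = solution (fst x 0 0) 0 + solution (fst y 0 0) 0" for x y :: series_pair
    using solution_add[OF zero_in_H zero_in_H, of "fst x 0 0" "fst y 0 0"] by simp
  have "H_scale z 0 = 0" for z by (simp add: H_scale_def zero_prod_def zero_fun_def)
  then show "solution (fst (H_scale z x) 0 0) 0 = H_scale z (solution (fst x 0 0) 0)" for z x
    using solution_scale[OF zero_in_H, of z "fst x 0 0"] by (simp add: H_scale_def)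
  have a00: "0 < a 0 0" using a by (simp add: coeff_cond_a_def)
  show "0 \<le> 2 / \<kappa>\<^sup>2 * a 0 0" using \<kappa> a00 by simp
  fix x assume x: "x \<in> H_space a"
  then have f: "fst x \<in> H1_space a" by (auto simp: H_space_def)
  have "1 / a 0 0 * (cmod (fst x 0 0))\<^sup>2 \<le> enn2real (series_sqnorm a (fst x))"
    using weighted_sq_le_energy[OF a f, of 0 0] sum_energy_le[OF a f, of "{0}"] by simp
  also have "\<dots> \<le> (H_norm a x)\<^sup>2" by (simp add: H_norm_sq)
  finally have "(cmod (fst x 0 0))\<^sup>2 \<le> a 0 0 * (H_norm a x)\<^sup>2"
    using a00 by (simp add: field_simps)
  then have le: "2 / \<kappa>\<^sup>2 * (cmod (fst x 0 0))\<^sup>2 \<le> 2 / \<kappa>\<^sup>2 * a 0 0 * (H_norm a x)\<^sup>2"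
    using \<kappa> by (simp add: mult.assoc divide_right_mono)
  show "\<exists>e. (\<forall>n. 0 \<le> e n) \<and> (\<forall>n. (\<Sum>j<n. e j) \<le> 2 / \<kappa>\<^sup>2 * a 0 0 * (H_norm a x)\<^sup>2) \<and>
     (\<forall>m k. (cmod (fst (solution (fst x 0 0) 0) m k))\<^sup>2 \<le> e (nat \<bar>m\<bar>) \<and>
            (cmod (snd (solution (fst x 0 0) 0) m k))\<^sup>2 \<le> e (nat \<bar>m\<bar>))"
    using solution_levelwise[OF zero_in_H, of "fst x 0 0"] order_trans[OF _ le]
    by (simp only: H_norm_zero power_zero_numeral mult_zero_right add_0_right) blast
qed

lemma solution_dirac:
  assumes "x \<in> dirac_dom a b cp cm"
  shows "solution 0 (dirac b cp cm x) = x - solution (fst x 0 0) 0"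
proof -
  have "x = solution (0 + fst x 0 0) (dirac b cp cm x + 0)"
    using eq_solution_dirac(2)[OF assms] by simp
  also have "\<dots> = solution 0 (dirac b cp cm x) + solution (fst x 0 0) 0"
    by (rule solution_add[OF eq_solution_dirac(1)[OF assms] zero_in_H])
  finally show ?thesis by (metis add_diff_cancel_right')
qed

end

lemma compact_operator_zero:
  assumes "coeff_cond_a a"
  shows "compact_operator a (\<lambda>_. 0)"
proof (rule compact_operatorI_levelwise[OF assms, of _ 0])
  show "0 = H_scale z 0" for z
    by (simp add: H_scale_def zero_prod_def zero_fun_def)
qed (auto intro: exI[of _ "\<lambda>_. 0"])

theorem theorem3p6:
  fixes a b cp cm :: "nat \<Rightarrow> nat \<Rightarrow> real"
  assumes "coeff_cond_a a"
    and "coeff_cond_b a b"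
    and "coeff_cond_c cp cm"
  shows "right_invertible a (dirac_dom a b cp cm) (dirac b cp cm) \<and>
         left_invertible_mod_compact a (dirac_dom a b cp cm) (dirac b cp cm) \<and>
         (\<exists>Q. parametrix a (dirac_dom a b cp cm) (dirac b cp cm) Q \<and> compact_operator a Q)"
proof -
  have "bounded (range (\<lambda>n. \<Sum>k. a n k / (b n k)\<^sup>2))"
    using assms(2) by (simp add: coeff_cond_b_def)
  then obtain \<tau> where \<tau>: "\<And>n. norm (\<Sum>k. a n k / (b n k)\<^sup>2) \<le> \<tau>"
    by (auto simp: bounded_iff)
  obtain \<kappa> where \<kappa>: "0 < \<kappa>"
    and prods: "\<And>n M N. M \<le> N \<Longrightarrow> \<kappa> \<le> (\<Prod>k=M..N. cp n k) \<and> (\<Prod>k=M..N. cp n k) \<le> 1 / \<kappa> \<and>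
        \<kappa> \<le> (\<Prod>k=M..N. cm n k) \<and> (\<Prod>k=M..N. cm n k) \<le> 1 / \<kappa>"
    using assms(3) unfolding coeff_cond_c_def by blast
  have "\<kappa> \<le> 1 / \<kappa>" using prods[of 0 0] by force
  then have "\<kappa> * \<kappa> \<le> 1" using \<kappa> by (simp add: field_simps)
  then have \<kappa>1: "\<kappa> \<le> 1"
    by (metis \<kappa> less_1_mult not_less)
  have inv: "1 \<le> 1 / \<kappa>" using \<kappa> \<kappa>1 by simp
  \<comment> \<open>The empty product at \<open>k = 0\<close> is not covered by the hypothesis and needs $\kappa \le 1$.\<close>
  have bounds: "\<kappa> \<le> (\<Prod>j<k. cp n j)" "(\<Prod>j<k. cp n j) \<le> 1 / \<kappa>"
      "\<kappa> \<le> (\<Prod>j<k. cm n j)" "(\<Prod>j<k. cm n j) \<le> 1 / \<kappa>" for n k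
    using prods[of 0 "k - 1" n] \<kappa>1 inv
    by (cases k; simp add: lessThan_Suc_atMost atLeast0AtMost)+
  interpret dirac_coefficients a b cp cm \<kappa> \<tau>
  proof
    show "(\<Sum>k. a n k / (b n k)\<^sup>2) \<le> \<tau>" for n
      using \<tau>[of n] by simp
  qed (use assms \<kappa> \<kappa>1 bounds in \<open>auto simp: coeff_cond_b_def coeff_cond_c_def\<close>)
  let ?S = "dirac_dom a b cp cm" and ?D = "dirac b cp cm" and ?Q = "solution 0"
  have Q: "bounded_operator a ?Q"
    using compact_solution_0 by (simp add: compact_operator_def)
  have right: "\<forall>x\<in>H_space a. ?Q x \<in> ?S \<and> ?D (?Q x) = x"
    using solution_in_dom dirac_solution by blast
  have left: "\<exists>C. compact_operator a C \<and> (\<forall>x\<in>?S. ?Q (?D x) = x - C x)"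
    using compact_kernel_part solution_dirac by blast
  have "\<forall>x\<in>H_space a. ?D (?Q x) = x - 0" using right by simp
  then have "parametrix a ?S ?D ?Q"
    unfolding parametrix_def using Q right left compact_operator_zero[OF a] by blast
  then show ?thesis
    unfolding right_invertible_def left_invertible_mod_compact_def
    using Q right left compact_solution_0 by blast
qed

end
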